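(* Let $T=(V,E)$ be a finite tree with at least one edge, and consider a solution of the inverse-weight Ricci flow (unnormalized or normalized) with positive initial metric. Let $c=(c_e)_{e\in E}$, $c_e=\lim_{t\to\infty}\kappa_e(t)$, be its limiting curvature vector, $c_*=\min_e c_e$, $E_*=\{e:c_e=c_*\}$. Then the set function $\beta$ is submodular, and $c$ is the unique solution of $$\min_{z\in B(\beta)}\frac12\sum_{e\in E}z_e^2 .$$ Let $\alpha_1<\cdots<\alpha_r$ be the distinct entries of $c$, and put $A_0=\varnothing$, $A_j=\{e\in E:c_e\le\alpha_j\}$ for $1\le j\le r$. Then $A_r=E$ and $$\beta(A_j)=\sum_{e\in A_j}c_e .$$ Moreover, for $0\le j<r$, $$\alpha_{j+1}=\min_{A_j\subsetneq A\subseteq E}\frac{\beta(A)-\beta(A_j)}{|A|-|A_j|},$$ and $A_{j+1}$ is the unique largest set attaining this minimum (so that this recursion determines $c$ from the tree alone, without reference to the initial metric). In particular, $$c_*=\min_{\varnothing\ne A\subseteq E}\lambda(A),$$ and $E_*$ is the unique largest set attaining this minimum; equivalently, $$E_*=\bigcup\{A\subseteq E:A\ne\varnothing,\ \beta(A)=c_*|A|\}.$$ In particular $\beta(E_* )=c_*|E_*|$. The sets attaining the minimum of $\lambda$ are closed under unions and under nonempty intersections.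
   Context: $T=(V,E)$ is a finite tree with at least one edge; $d_x$ is the combinatorial degree of $x\in V$ and $E(x)$ the set of edges incident to $x$. A positive metric is $w=(w_e)_{e\in E}$ with all $w_e>0$; it induces the path metric $d_w$ on $V$. Put $D_x(w)=\sum_{e\ni x}1/w_e$. For $\alpha\in[0,1)$ let $m_x^\alpha(x)=\alpha$ and $m_x^\alpha(z)=(1-\alpha)\,w_{xz}^{-1}/D_x(w)$ for $z\sim x$. The (inverse-weight) Lin--Lu--Yau curvature of $e=xy$ is $\kappa_e(w)=\lim_{\alpha\uparrow1}\frac{1-W_1(m_x^\alpha,m_y^\alpha)/w_e}{1-\alpha}$, with $W_1$ the $1$-Wasserstein distance for $d_w$. Known formula on trees: $\kappa_{xy}(w)=\frac{2-d_x}{w_{xy}D_x(w)}+\frac{2-d_y}{w_{xy}D_y(w)}$. The unnormalized flow is $\dot{\widetilde w}_e=-\kappa_e(\widetilde w)\widetilde w_e$; the normalized flow is $\dot w_e=-w_e(\kappa_e(w)-K(w))$, $K(w)=\sum_f w_f\kappa_f(w)$, $\sum_e w_e(0)=1$, and is obtained from the unnormalized one by dividing by the total edge length; both have the same curvatures $\kappa_e(t)$. For every positive initial metric the limits $c_e=\lim_{t\to\infty}\kappa_e(t)$ exist. For $A\subseteq E$ set $\beta(A)=\sum_{x\in V,\,E(x)\subseteq A}(2-d_x)$ and, if $A\neq\varnothing$, $\lambda(A)=\beta(A)/|A|$. For $z\in\mathbb R^E$ write $z(A)=\sum_{e\in A}z_e$, and let $B(\beta)=\{z\in\mathbb R^E: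 z(A)\le\beta(A)\text{ for every }A\subseteq E,\ z(E)=\beta(E)\}$. Submodular means $\beta(A\cup B)+\beta(A\cap B)\le\beta(A)+\beta(B)$ for all $A,B\subseteq E$. "Unique largest" means that it attains the minimum and contains every set attaining the minimum. *)

theory Defs
  imports "HOL-Analysis.Analysis"
begin

section \<open>Finite trees\<close>

text \<open>
  An undirected edge is the two-element set of its end points. (The predicate \<open>tree\<close> of the
  AFP entry \<open>Graph_Theory\<close> excludes directed cycles only, which is not the undirected notion.)
\<close>

definition gwalk :: "'a set set \<Rightarrow> 'a list \<Rightarrow> bool" where
  "gwalk E xs \<longleftrightarrow> xs \<noteq> [] \<and> successively (\<lambda>x y. {x, y} \<in> E) xs"

definition gwalk_betw :: "'a set set \<Rightarrow> 'a \<Rightarrow> 'a list \<Rightarrow> 'a \<Rightarrow> bool" where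
  "gwalk_betw E x xs y \<longleftrightarrow> gwalk E xs \<and> hd xs = x \<and> last xs = y"

definition gcycle :: "'a set set \<Rightarrow> 'a list \<Rightarrow> bool" where
  "gcycle E xs \<longleftrightarrow> gwalk E xs \<and> distinct xs \<and> length xs \<ge> 3 \<and> {last xs, hd xs} \<in> E"

definition finite_tree :: "'a set \<Rightarrow> 'a set set \<Rightarrow> bool" where
  "finite_tree V E \<longleftrightarrow> finite V \<and> V \<noteq> {}
     \<and> (\<forall>e\<in>E. e \<subseteq> V \<and> card e = 2)
     \<and> (\<forall>x\<in>V. \<forall>y\<in>V. \<exists>xs. gwalk_betw E x xs y)
     \<and> (\<nexists>xs. gcycle E xs)"

definition incident :: "'a set set \<Rightarrow> 'a \<Rightarrow> 'a set set" where
  "incident E x = {e \<in> E. x \<in> e}"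

definition gdegree :: "'a set set \<Rightarrow> 'a \<Rightarrow> nat" where
  "gdegree E x = card (incident E x)"


section \<open>Path metric and Wasserstein distance\<close>

definition walk_length :: "('a set \<Rightarrow> real) \<Rightarrow> 'a list \<Rightarrow> real" where
  "walk_length w xs = (\<Sum>(x, y) \<leftarrow> zip xs (tl xs). w {x, y})"

definition path_metric :: "'a set set \<Rightarrow> ('a set \<Rightarrow> real) \<Rightarrow> 'a \<Rightarrow> 'a \<Rightarrow> real" where
  "path_metric E w x y = Inf {walk_length w xs | xs. gwalk_betw E x xs y}"

definition coupling :: "'a set \<Rightarrow> ('a \<Rightarrow> real) \<Rightarrow> ('a \<Rightarrow> real) \<Rightarrow> ('a \<Rightarrow> 'a \<Rightarrow> real) \<Rightarrow> bool" where
  "coupling V \<mu> \<nu> \<pi> \<longleftrightarrow> (\<forall>u\<in>V. \<forall>v\<in>V. 0 \<le> \<pi> u v)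
     \<and> (\<forall>u\<in>V. (\<Sum>v\<in>V. \<pi> u v) = \<mu> u)
     \<and> (\<forall>v\<in>V. (\<Sum>u\<in>V. \<pi> u v) = \<nu> v)"

definition wasserstein1 ::
    "'a set \<Rightarrow> ('a \<Rightarrow> 'a \<Rightarrow> real) \<Rightarrow> ('a \<Rightarrow> real) \<Rightarrow> ('a \<Rightarrow> real) \<Rightarrow> real" where
  "wasserstein1 V d \<mu> \<nu> = Inf {(\<Sum>u\<in>V. \<Sum>v\<in>V. \<pi> u v * d u v) | \<pi>. coupling V \<mu> \<nu> \<pi>}"


section \<open>Inverse-weight Lin--Lu--Yau curvature and Ricci flow\<close>

definition inv_weight_sum :: "'a set set \<Rightarrow> ('a set \<Rightarrow> real) \<Rightarrow> 'a \<Rightarrow> real" where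
  "inv_weight_sum E w x = (\<Sum>e\<in>incident E x. 1 / w e)"

definition lazy_measure :: "'a set set \<Rightarrow> ('a set \<Rightarrow> real) \<Rightarrow> real \<Rightarrow> 'a \<Rightarrow> 'a \<Rightarrow> real" where
  "lazy_measure E w a x z =
     (if z = x then a
      else if {x, z} \<in> E then (1 - a) * inverse (w {x, z}) / inv_weight_sum E w x
      else 0)"

definition lly_curvature ::
    "'a set \<Rightarrow> 'a set set \<Rightarrow> ('a set \<Rightarrow> real) \<Rightarrow> 'a \<Rightarrow> 'a \<Rightarrow> real" where
  "lly_curvature V E w x y =
     Lim (at_left 1) (\<lambda>a.
       (1 - wasserstein1 V (path_metric E w) (lazy_measure E w a x) (lazy_measure E w a y) / w {x, y})
       / (1 - a))"

text \<open>
  The curvature of \<open>{x, y}\<close> does not depend on the order of the end points, so the description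
  below has exactly one solution for every edge.
\<close>

definition edge_curvature ::
    "'a set \<Rightarrow> 'a set set \<Rightarrow> ('a set \<Rightarrow> real) \<Rightarrow> 'a set \<Rightarrow> real" where
  "edge_curvature V E w e = (THE k. \<forall>x y. e = {x, y} \<longrightarrow> k = lly_curvature V E w x y)"

definition positive_metric :: "'a set set \<Rightarrow> ('a set \<Rightarrow> real) \<Rightarrow> bool" where
  "positive_metric E w \<longleftrightarrow> (\<forall>e\<in>E. 0 < w e)"

definition unnormalized_ricci_flow ::
    "'a set \<Rightarrow> 'a set set \<Rightarrow> (real \<Rightarrow> 'a set \<Rightarrow> real) \<Rightarrow> bool" where
  "unnormalized_ricci_flow V E w \<longleftrightarrow>
     (\<forall>t\<ge>0. positive_metric E (w t) \<and>
       (\<forall>e\<in>E. ((\<lambda>s. w s e) has_real_derivative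
                 - edge_curvature V E (w t) e * w t e) (at t within {0..})))"

definition mean_curvature :: "'a set \<Rightarrow> 'a set set \<Rightarrow> ('a set \<Rightarrow> real) \<Rightarrow> real" where
  "mean_curvature V E w = (\<Sum>f\<in>E. w f * edge_curvature V E w f)"

definition normalized_ricci_flow ::
    "'a set \<Rightarrow> 'a set set \<Rightarrow> (real \<Rightarrow> 'a set \<Rightarrow> real) \<Rightarrow> bool" where
  "normalized_ricci_flow V E w \<longleftrightarrow>
     (\<Sum>e\<in>E. w 0 e) = 1 \<and>
     (\<forall>t\<ge>0. positive_metric E (w t) \<and>
       (\<forall>e\<in>E. ((\<lambda>s. w s e) has_real_derivative
                 - (w t e * (edge_curvature V E (w t) e - mean_curvature V E (w t))))
               (at t within {0..})))"

definition ricci_flow :: "'a set \<Rightarrow> 'a set set \<Rightarrow> (real \<Rightarrow> 'a set \<Rightarrow> real) \<Rightarrow> bool" where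
  "ricci_flow V E w \<longleftrightarrow> unnormalized_ricci_flow V E w \<or> normalized_ricci_flow V E w"

definition limit_curvature ::
    "'a set \<Rightarrow> 'a set set \<Rightarrow> (real \<Rightarrow> 'a set \<Rightarrow> real) \<Rightarrow> 'a set \<Rightarrow> real" where
  "limit_curvature V E w e = Lim at_top (\<lambda>t. edge_curvature V E (w t) e)"


section \<open>Set functions\<close>

definition beta :: "'a set \<Rightarrow> 'a set set \<Rightarrow> 'a set set \<Rightarrow> real" where
  "beta V E A = (\<Sum>x \<in> {x \<in> V. incident E x \<subseteq> A}. 2 - real (gdegree E x))"

definition slope :: "('e set \<Rightarrow> real) \<Rightarrow> 'e set \<Rightarrow> 'e set \<Rightarrow> real" where
  "slope f B A = (f A - f B) / (real (card A) - real (card B))"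

definition avg_density :: "('e set \<Rightarrow> real) \<Rightarrow> 'e set \<Rightarrow> real" where
  "avg_density f A = f A / real (card A)"

definition submodular_on :: "'e set \<Rightarrow> ('e set \<Rightarrow> real) \<Rightarrow> bool" where
  "submodular_on E f \<longleftrightarrow> (\<forall>A B. A \<subseteq> E \<and> B \<subseteq> E \<longrightarrow> f (A \<union> B) + f (A \<inter> B) \<le> f A + f B)"

text \<open>
  Vectors indexed by \<open>E\<close> are functions of which only the values on \<open>E\<close> matter.
\<close>

definition base_polytope :: "'e set \<Rightarrow> ('e set \<Rightarrow> real) \<Rightarrow> ('e \<Rightarrow> real) set" where
  "base_polytope E f = {z. (\<forall>A\<subseteq>E. sum z A \<le> f A) \<and> sum z E = f E}"

definition unique_largest_minimizer ::
    "('e set \<Rightarrow> real) \<Rightarrow> 'e set set \<Rightarrow> 'e set \<Rightarrow> bool" where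
  "unique_largest_minimizer f \<F> M \<longleftrightarrow>
     is_arg_min f (\<lambda>A. A \<in> \<F>) M \<and> (\<forall>A. is_arg_min f (\<lambda>A. A \<in> \<F>) A \<longrightarrow> A \<subseteq> M)"

end

theory Submission
  imports Defs
begin

text \<open>
  In the coordinates \<open>\<theta> e = ln (w e)\<close> the flow is the gradient flow of the convex function
  \<open>F \<theta> = \<Sum>x. (d x - 2) ln (\<Sum>e\<ni>x. exp (- \<theta> e))\<close>: the summand of a leaf is linear, the others are
  nonnegative multiples of log-sum-exp functions. A gradient flow of a convex function satisfies
  \<open>|\<nabla>F (\<theta> t)|\<^sup>2 \<le> |\<nabla>F y|\<^sup>2 + |\<theta> 0 - y|\<^sup>2 / t\<^sup>2\<close> for every \<open>y\<close>, so its gradient converges to the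
  point \<open>p\<close> of minimal norm in the closure of the range of \<open>\<nabla>F\<close>. Since a tree has no cycles, this
  closure consists of all \<open>\<Sum>x. (2 - d x) q x\<close> with \<open>q x\<close> a probability vector on the edges at \<open>x\<close>.
  Minimality forces \<open>q x\<close>, for \<open>d x > 2\<close>, to live on the edges at \<open>x\<close> where \<open>p\<close> is largest; hence
  \<open>p (A) = \<beta> (A)\<close> for every sublevel set \<open>A\<close> of \<open>p\<close>. Together with \<open>p \<in> B(\<beta>)\<close> this identifies \<open>p\<close>
  as the point of minimal norm of \<open>B(\<beta>)\<close> and yields the recursion for its values.
\<close>

section \<open>Wasserstein distance and curvature on trees\<close>

text \<open>The connected component of \<open>a\<close> after the edge \<open>e\<close> has been
  deleted.\<close>

definition edge_side :: "'a set set \<Rightarrow> 'a set \<Rightarrow> 'a \<Rightarrow> 'a set" where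
  "edge_side E e a = {u. \<exists>xs. gwalk_betw (E - {e}) a xs u}"

lemma edge_side_self: "a \<in> edge_side E e a"
  by (auto simp: edge_side_def gwalk_betw_def gwalk_def intro!: exI[of _ "[a]"])

lemma edge_side_step:
  assumes "{u, v} \<in> E" "{u, v} \<noteq> e" "u \<in> edge_side E e a"
  shows "v \<in> edge_side E e a"
proof -
  obtain xs where "gwalk_betw (E - {e}) a xs u"
    using assms(3) by (auto simp: edge_side_def)
  hence "gwalk_betw (E - {e}) a (xs @ [v]) v"
    using assms(1,2) by (auto simp: gwalk_betw_def gwalk_def successively_append_iff)
  thus ?thesis by (auto simp: edge_side_def)
qed

text \<open>Cutting out the stretch between two visits to the same vertex shortens the walk, so
  induction on its length ends with a simple one.\<close>

lemma gwalk_betw_distinct: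
  assumes "gwalk_betw E a xs b"
  shows "\<exists>ys. gwalk_betw E a ys b \<and> distinct ys"
  using assms
proof (induction "length xs" arbitrary: xs rule: less_induct)
  case less
  show ?case
  proof (cases "distinct xs")
    case False
    then obtain as bs cs y where xs: "xs = as @ [y] @ bs @ [y] @ cs"
      using not_distinct_decomp by blast
    have "gwalk_betw E a (as @ [y] @ cs) b"
      using less.prems unfolding xs gwalk_betw_def gwalk_def successively_append_iff
      by (cases "as = []"; cases "cs = []") simp_all
    thus ?thesis using less.hyps[of "as @ [y] @ cs"] by (simp add: xs)
  qed (use less.prems in blast)
qed

text \<open>A simple walk from \<open>a\<close> to \<open>b\<close> avoiding the edge between them
  would close up to a cycle through that edge; one or two vertices are ruled out by
  \<open>a \<noteq> b\<close> and by the missing edge.\<close>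

lemma edge_side_other:
  assumes "\<nexists>xs. gcycle E xs" "{a, b} \<in> E" "a \<noteq> b"
  shows "b \<notin> edge_side E {a, b} a"
proof
  assume "b \<in> edge_side E {a, b} a"
  then obtain xs where "gwalk_betw (E - {{a, b}}) a xs b" by (auto simp: edge_side_def)
  from gwalk_betw_distinct[OF this]
  obtain ys where ys: "gwalk_betw (E - {{a, b}}) a ys b" "distinct ys" by blast
  have succ: "successively (\<lambda>x y. {x, y} \<in> E - {{a, b}}) ys" and ne: "ys \<noteq> []"
    and hl: "hd ys = a" "last ys = b"
    using ys by (simp_all add: gwalk_betw_def gwalk_def)
  have "length ys \<noteq> 0" "length ys \<noteq> 1" "length ys \<noteq> 2"
    using succ ne hl assms(3) by (auto simp: length_Suc_conv numeral_2_eq_2)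
  hence "length ys \<ge> 3" by linarith
  moreover have "gwalk E ys"
    using successively_mono[OF succ, of "\<lambda>x y. {x, y} \<in> E"] ne by (simp add: gwalk_def)
  moreover have "{last ys, hd ys} \<in> E" using hl assms(2) by (simp add: insert_commute)
  ultimately have "gcycle E ys" using ys(2) by (simp add: gcycle_def)
  thus False using assms(1) by blast
qed

section \<open>Stars, degrees and potentials on a tree\<close>

locale nontrivial_tree =
  fixes V :: "'a set" and E :: "'a set set"
  assumes tree: "finite_tree V E" and edges_ne: "E \<noteq> {}"
begin

abbreviation deg :: "'a \<Rightarrow> nat" where "deg \<equiv> gdegree E"

definition nbrs :: "'a \<Rightarrow> 'a set" where "nbrs x = {z. {x, z} \<in> E}"

lemma finite_V: "finite V" and edge_subset: "e \<in> E \<Longrightarrow> e \<subseteq> V"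
  and edge_card: "e \<in> E \<Longrightarrow> card e = 2"
  and connected: "x \<in> V \<Longrightarrow> y \<in> V \<Longrightarrow> \<exists>xs. gwalk_betw E x xs y"
  and acyclic: "\<nexists>xs. gcycle E xs"
  using tree by (auto simp: finite_tree_def)

lemma finite_E: "finite E"
  using finite_V edge_subset by (meson PowI finite_Pow_iff finite_subset subsetI)

lemma edgeD: "{x, y} \<in> E \<Longrightarrow> x \<noteq> y \<and> x \<in> V \<and> y \<in> V"
  using edge_card[of "{x, y}"] edge_subset[of "{x, y}"] by (cases "x = y") auto

lemma edgeE: assumes "e \<in> E" obtains x y where "e = {x, y}" "x \<noteq> y"
  using edge_card[OF assms] by (auto simp: card_2_iff)

lemma finite_incident: "finite (incident E x)"
  using finite_E by (simp add: incident_def)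

lemma nbrs_subset: "nbrs x \<subseteq> V - {x}" and finite_nbrs: "finite (nbrs x)"
proof -
  show *: "nbrs x \<subseteq> V - {x}" using edgeD by (auto simp: nbrs_def)
  show "finite (nbrs x)" using finite_subset[OF *] finite_V by simp
qed

lemma bij_nbrs_incident: "bij_betw (\<lambda>z. {x, z}) (nbrs x) (incident E x)"
proof (rule bij_betwI')
  fix e assume e: "e \<in> incident E x"
  then obtain a b where "e = {a, b}" "a \<noteq> b" by (auto simp: incident_def elim: edgeE)
  thus "\<exists>z\<in>nbrs x. e = {x, z}" using e
    by (auto simp: incident_def nbrs_def insert_commute)
qed (auto simp: incident_def nbrs_def doubleton_eq_iff)

lemma sum_incident: "(\<Sum>e\<in>incident E x. g e) = (\<Sum>z\<in>nbrs x. g {x, z})"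
  by (rule sum.reindex_bij_betw[OF bij_nbrs_incident, symmetric])

lemma deg_nbrs: "deg x = card (nbrs x)"
  using bij_betw_same_card[OF bij_nbrs_incident[of x]] by (simp add: gdegree_def)

lemma incident_nonempty: assumes "x \<in> V" shows "incident E x \<noteq> {}"
proof -
  obtain a b where ab: "{a, b} \<in> E" "a \<noteq> b" using edges_ne edgeE by (metis ex_in_conv)
  then obtain y where y: "y \<in> V" "y \<noteq> x" using edgeD by metis
  obtain xs where xs: "gwalk_betw E x xs y" using connected[OF assms y(1)] by blast
  then obtain z zs where "xs = x # z # zs"
    using y(2) by (cases xs; cases "tl xs") (auto simp: gwalk_betw_def gwalk_def)
  hence "{x, z} \<in> E" using xs by (auto simp: gwalk_betw_def gwalk_def)
  thus ?thesis by (auto simp: incident_def)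
qed

lemma deg_pos: "x \<in> V \<Longrightarrow> deg x \<ge> 1"
  using incident_nonempty finite_incident by (simp add: gdegree_def Suc_le_eq card_gt_0_iff)

text \<open>Deleting an edge separates its ends, so the indicator of one side jumps across that edge
  and no other. Adding up these indicators with weights from \<open>h\<close> solves the equation on
  all edges at once; antisymmetry makes the chosen orientation irrelevant.\<close>

lemma tree_potential:
  fixes h :: "'a \<Rightarrow> 'a \<Rightarrow> real"
  assumes antisym: "\<And>u v. h u v = - h v u"
  shows "\<exists>\<phi>. \<forall>u v. {u, v} \<in> E \<longrightarrow> \<phi> u - \<phi> v = h u v"
proof -
  have "\<forall>e\<in>E. \<exists>a b. e = {a, b}" by (meson edgeE)
  then obtain s t where st: "\<And>e. e \<in> E \<Longrightarrow> e = {s e, t e}" by metis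
  define ind where "ind e u = (of_bool (u \<in> edge_side E e (s e)) :: real)" for e u
  define \<phi> where "\<phi> u = (\<Sum>e\<in>E. h (s e) (t e) * ind e u)" for u
  have "\<phi> u - \<phi> v = h u v" if uv: "{u, v} \<in> E" for u v
  proof -
    have same: "ind e u = ind e v" if "e \<noteq> {u, v}" for e
      using edge_side_step[of u v E e "s e"] edge_side_step[of v u E e "s e"] uv that
      by (auto simp: ind_def insert_commute)
    have "\<phi> u - \<phi> v = (\<Sum>e\<in>E. h (s e) (t e) * (ind e u - ind e v))"
      by (simp add: \<phi>_def sum_subtractf right_diff_distrib)
    also have "\<dots> = (\<Sum>e\<in>E. if e = {u, v} then h (s {u, v}) (t {u, v}) * (ind {u, v} u - ind {u, v} v) else 0)"
      using same by (intro sum.cong) auto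
    also have "\<dots> = h (s {u, v}) (t {u, v}) * (ind {u, v} u - ind {u, v} v)"
      using uv finite_E by simp
    also have "\<dots> = h u v"
    proof -
      have ne: "u \<noteq> v" using edgeD[OF uv] by blast
      have "u = s {u, v} \<and> v = t {u, v} \<or> u = t {u, v} \<and> v = s {u, v}"
        using st[OF uv] by (metis doubleton_eq_iff)
      moreover have "u \<notin> edge_side E {u, v} v" "v \<notin> edge_side E {u, v} u"
        using edge_side_other[OF acyclic, of u v] edge_side_other[OF acyclic, of v u] uv ne
        by (auto simp: insert_commute)
      ultimately show ?thesis
        using antisym[of u v] edge_side_self[of u E "{u, v}"] edge_side_self[of v E "{u, v}"]
        by (elim disjE conjE) (simp_all add: ind_def)
    qed
    finally show ?thesis .
  qed
  thus ?thesis by blast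
qed

lemma lipschitz_walk:
  assumes lip: "\<And>u v. {u, v} \<in> E \<Longrightarrow> f u - f v \<le> w {u, v}"
    and walk: "gwalk_betw E u xs v"
  shows "f u - f v \<le> walk_length w xs"
  using walk
proof (induction xs arbitrary: u)
  case (Cons x xs)
  show ?case
  proof (cases xs)
    case Nil
    thus ?thesis using Cons.prems by (auto simp: gwalk_betw_def walk_length_def)
  next
    case (Cons y ys)
    have "gwalk_betw E y xs v" "{x, y} \<in> E" "u = x"
      using Cons.prems by (auto simp: Cons gwalk_betw_def gwalk_def)
    from Cons.IH[OF this(1)] lip[OF this(2)] this(3) show ?thesis
      by (simp add: Cons walk_length_def)
  qed
qed (simp add: gwalk_betw_def gwalk_def)

section \<open>Path metric, lazy measures and optimal transport for a positive metric\<close>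

context
  fixes w :: "'a set \<Rightarrow> real"
  assumes pos: "positive_metric E w"
begin

lemma w_pos: "e \<in> E \<Longrightarrow> 0 < w e" using pos by (simp add: positive_metric_def)

lemma path_metric_le:
  assumes "gwalk_betw E u xs v"
  shows "path_metric E w u v \<le> walk_length w xs"
  unfolding path_metric_def
proof (rule cInf_lower)
  \<comment> \<open>Compared with a constant function, \<open>lipschitz_walk\<close> says that walk
    lengths are nonnegative.\<close>
  show "bdd_below {walk_length w xs |xs. gwalk_betw E u xs v}"
    using lipschitz_walk[of "\<lambda>_. 0" w] w_pos by (intro bdd_belowI[of _ 0]) (auto simp: less_imp_le)
qed (use assms in blast)

lemma path_metric_ge:
  assumes "\<And>u v. {u, v} \<in> E \<Longrightarrow> f u - f v \<le> w {u, v}" "u \<in> V" "v \<in> V"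
  shows "f u - f v \<le> path_metric E w u v"
  unfolding path_metric_def
  using connected[OF assms(2,3)] lipschitz_walk[of f w, OF assms(1)]
  by (intro cInf_greatest) auto

lemma inv_weight_sum_pos: "x \<in> V \<Longrightarrow> 0 < inv_weight_sum E w x"
  unfolding inv_weight_sum_def
  using incident_nonempty finite_incident w_pos by (intro sum_pos) (auto simp: incident_def)

lemma lazy_measure_nonneg:
  assumes "x \<in> V" "0 \<le> a" "a \<le> 1"
  shows "0 \<le> lazy_measure E w a x z"
  using assms inv_weight_sum_pos[of x] w_pos[of "{x, z}"] by (auto simp: lazy_measure_def)

text \<open>The mean is split into the value at the centre and the slopes along the star, because
  the transport potential used later has slope 1 or -1 on every edge of that star.\<close>

lemma sum_lazy_measure:
  assumes x: "x \<in> V"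
  shows "(\<Sum>z\<in>V. lazy_measure E w a x z * g z)
    = g x + (1 - a) / inv_weight_sum E w x * (\<Sum>z\<in>nbrs x. (g z - g x) / w {x, z})"
proof -
  define D where "D = inv_weight_sum E w x"
  have D: "D \<noteq> 0" "D = (\<Sum>z\<in>nbrs x. 1 / w {x, z})"
    using inv_weight_sum_pos[OF x] by (simp_all add: D_def inv_weight_sum_def sum_incident)
  have "(\<Sum>z\<in>V. lazy_measure E w a x z * g z) = a * g x + (\<Sum>z\<in>V - {x}. lazy_measure E w a x z * g z)"
    using x finite_V by (subst sum.remove[of _ x]) (auto simp: lazy_measure_def)
  also have "(\<Sum>z\<in>V - {x}. lazy_measure E w a x z * g z) = (\<Sum>z\<in>nbrs x. lazy_measure E w a x z * g z)"
    using nbrs_subset finite_V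
    by (intro sum.mono_neutral_right) (auto simp: lazy_measure_def nbrs_def)
  also have "\<dots> = (\<Sum>z\<in>nbrs x. (1 - a) / D * (g z / w {x, z}))"
    using nbrs_subset[of x] by (intro sum.cong) (auto simp: lazy_measure_def D_def nbrs_def divide_simps)
  also have "\<dots> = (1 - a) / D * (\<Sum>z\<in>nbrs x. g z / w {x, z})" by (simp add: sum_distrib_left)
  also have "(\<Sum>z\<in>nbrs x. g z / w {x, z}) = (\<Sum>z\<in>nbrs x. (g z - g x) / w {x, z}) + g x * D"
    by (simp add: D(2) sum_distrib_left diff_divide_distrib sum_subtractf)
  finally show ?thesis using D(1) by (simp add: D_def[symmetric] field_simps)
qed

lemma lazy_measure_mass: "x \<in> V \<Longrightarrow> (\<Sum>z\<in>V. lazy_measure E w a x z) = 1"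
  using sum_lazy_measure[of x a "\<lambda>_. 1"] by simp

text \<open>The cost of a difference of potentials sees only the marginals, so a potential yields a
  lower bound common to all couplings.\<close>

lemma coupling_cost_potential:
  assumes "coupling V \<mu> \<nu> \<pi>"
  shows "(\<Sum>u\<in>V. \<Sum>v\<in>V. \<pi> u v * (f u - f v)) = (\<Sum>u\<in>V. \<mu> u * f u) - (\<Sum>v\<in>V. \<nu> v * f v)"
proof -
  have "(\<Sum>u\<in>V. \<Sum>v\<in>V. \<pi> u v * (f u - f v))
      = (\<Sum>u\<in>V. (\<Sum>v\<in>V. \<pi> u v) * f u) - (\<Sum>u\<in>V. \<Sum>v\<in>V. \<pi> u v * f v)"
    by (simp add: right_diff_distrib sum_subtractf sum_distrib_right)
  also have "(\<Sum>u\<in>V. \<Sum>v\<in>V. \<pi> u v * f v) = (\<Sum>v\<in>V. (\<Sum>u\<in>V. \<pi> u v) * f v)"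
    by (subst sum.swap) (simp add: sum_distrib_right)
  finally show ?thesis using assms by (simp add: coupling_def)
qed

text \<open>
  The potential \<open>f\<close> climbs at unit speed along every edge touching \<open>{x, y}\<close>, directed from
  \<open>y\<close> to \<open>x\<close>. Hence every coupling that moves no mass from \<open>y\<close> to \<open>x\<close> is optimal.
\<close>

lemma wasserstein_lazy:
  assumes xy: "{x, y} \<in> E" and a: "1 / 2 < a" "a < 1"
  shows "wasserstein1 V (path_metric E w) (lazy_measure E w a x) (lazy_measure E w a y)
    = w {x, y} + (1 - a) * ((real (deg x) - 2) / inv_weight_sum E w x
                          + (real (deg y) - 2) / inv_weight_sum E w y)"
    (is "wasserstein1 V ?d ?\<mu> ?\<nu> = ?R")
proof -
  have ne: "x \<noteq> y" "x \<in> V" "y \<in> V" using edgeD[OF xy] by auto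
  \<comment> \<open>The three clauses orient the other edges at \<open>x\<close>, the other edges at
    \<open>y\<close>, and the edge \<open>{x, y}\<close> itself; on edges touching neither end both
    values vanish and \<open>f\<close> is flat.\<close>
  define g where "g u v = (if v = x \<and> u \<noteq> y \<or> u = y \<and> v \<noteq> x \<or> u = x \<and> v = y
    then 1 else 0 :: real)" for u v
  have g01: "0 \<le> g u v" "g u v \<le> 1" for u v by (auto simp: g_def)
  have "w {u, v} * (g u v - g v u) = - (w {v, u} * (g v u - g u v))" for u v
    by (simp add: insert_commute[of v u] right_diff_distrib)
  from tree_potential[of "\<lambda>u v. w {u, v} * (g u v - g v u)", OF this]
  obtain f where f: "\<And>u v. {u, v} \<in> E \<Longrightarrow> f u - f v = w {u, v} * (g u v - g v u)"
    by blast
  have lip: "f u - f v \<le> w {u, v}" if "{u, v} \<in> E" for u v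
  proof -
    have "g u v - g v u \<le> 1" using g01(1)[of v u] g01(2)[of u v] by linarith
    from mult_left_mono[OF this less_imp_le[OF w_pos[OF that]]] show ?thesis
      by (simp add: f[OF that])
  qed
  have "g x y = 1" "g y x = 0" using ne by (simp_all add: g_def)
  hence fxy: "f x - f y = w {x, y}" by (simp add: f[OF xy])
  have fx: "f z - f x = w {x, z}" if z: "z \<in> nbrs x" "z \<noteq> y" for z
  proof -
    have zx: "{z, x} \<in> E" "z \<noteq> x" using z nbrs_subset[of x] by (auto simp: nbrs_def insert_commute)
    have "g z x = 1" "g x z = 0" using ne z(2) zx(2) by (simp_all add: g_def)
    thus ?thesis using f[OF zx(1)] by (simp add: insert_commute[of z x])
  qed
  have fy: "f z - f y = - w {y, z}" if z: "z \<in> nbrs y" "z \<noteq> x" for z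
  proof -
    have zy: "{z, y} \<in> E" "z \<noteq> y" using z nbrs_subset[of y] by (auto simp: nbrs_def insert_commute)
    have "g z y = 0" "g y z = 1" using ne z(2) zy(2) by (simp_all add: g_def)
    thus ?thesis using f[OF zy(1)] by (simp add: insert_commute[of z y])
  qed
  have nb: "y \<in> nbrs x" "x \<in> nbrs y" using xy by (auto simp: nbrs_def insert_commute)
  have nz: "w {x, z} \<noteq> 0" if "z \<in> nbrs x" for x z using that w_pos by (force simp: nbrs_def)
  have cards: "real (card (nbrs x - {y})) = real (deg x) - 1" "real (card (nbrs y - {x})) = real (deg y) - 1"
    using nb finite_nbrs deg_pos[of x] deg_pos[of y] ne
    by (simp_all add: deg_nbrs of_nat_diff)
  have "(\<Sum>z\<in>nbrs x. (f z - f x) / w {x, z}) = -1 + (\<Sum>z\<in>nbrs x - {y}. (f z - f x) / w {x, z})"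
    using nb finite_nbrs fxy nz[OF nb(1)] by (subst sum.remove[of _ y]) (auto simp: field_simps)
  also have "(\<Sum>z\<in>nbrs x - {y}. (f z - f x) / w {x, z}) = (\<Sum>z\<in>nbrs x - {y}. 1)"
    using fx nz by (intro sum.cong) auto
  finally have sx: "(\<Sum>z\<in>nbrs x. (f z - f x) / w {x, z}) = real (deg x) - 2" using cards by simp
  have "(\<Sum>z\<in>nbrs y. (f z - f y) / w {y, z}) = 1 + (\<Sum>z\<in>nbrs y - {x}. (f z - f y) / w {y, z})"
    using nb finite_nbrs fxy nz[OF nb(2)] by (subst sum.remove[of _ x]) (auto simp: insert_commute)
  also have "(\<Sum>z\<in>nbrs y - {x}. (f z - f y) / w {y, z}) = (\<Sum>z\<in>nbrs y - {x}. - 1)"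
    using fy nz by (intro sum.cong) auto
  finally have sy: "(\<Sum>z\<in>nbrs y. (f z - f y) / w {y, z}) = 2 - real (deg y)" using cards by simp
  have val: "(\<Sum>u\<in>V. ?\<mu> u * f u) - (\<Sum>v\<in>V. ?\<nu> v * f v) = ?R"
    unfolding sum_lazy_measure[OF ne(2)] sum_lazy_measure[OF ne(3)] sx sy
    using fxy by (simp add: algebra_simps diff_divide_distrib)
  have lower: "?R \<le> (\<Sum>u\<in>V. \<Sum>v\<in>V. \<pi> u v * ?d u v)" if "coupling V ?\<mu> ?\<nu> \<pi>" for \<pi>
    unfolding val[symmetric] coupling_cost_potential[OF that, of f, symmetric]
    using that path_metric_ge[of f, OF lip]
    by (intro sum_mono mult_left_mono) (auto simp: coupling_def)
  \<comment> \<open>The mass common to both measures at \<open>x\<close> and at \<open>y\<close>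
    stays in place, and the remainders, each of total mass \<open>M\<close>, are coupled
    independently. The bound \<open>1 / 2 < a\<close> gives \<open>M > 0\<close> and keeps the
    remainders at \<open>x\<close> and \<open>y\<close> nonnegative.\<close>
  define \<delta> where "\<delta> u = (if u = x then ?\<nu> x else if u = y then ?\<mu> y else 0)" for u
  define M where "M = 1 - ?\<nu> x - ?\<mu> y"
  define \<pi> where "\<pi> u v = (if u = v then \<delta> u else 0) + (?\<mu> u - \<delta> u) * (?\<nu> v - \<delta> v) / M" for u v
  have nonneg: "0 \<le> ?\<mu> u" "0 \<le> ?\<nu> u" for u
    using lazy_measure_nonneg[of x a u] lazy_measure_nonneg[of y a u] ne a by auto
  have diag: "?\<mu> x = a" "?\<nu> y = a" by (simp_all add: lazy_measure_def)
  have "?\<mu> x + ?\<mu> y \<le> (\<Sum>z\<in>V. ?\<mu> z)"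
    using sum_mono2[of V "{x, y}" ?\<mu>] finite_V ne nonneg by auto
  hence small_x: "?\<mu> y \<le> 1 - a" using lazy_measure_mass[OF ne(2), of a] diag by simp
  have "?\<nu> x + ?\<nu> y \<le> (\<Sum>z\<in>V. ?\<nu> z)"
    using sum_mono2[of V "{x, y}" ?\<nu>] finite_V ne nonneg by auto
  hence small_y: "?\<nu> x \<le> 1 - a" using lazy_measure_mass[OF ne(3), of a] diag by simp
  have M: "M > 0" using small_x small_y a by (simp add: M_def)
  have sum\<delta>: "(\<Sum>u\<in>V. \<delta> u) = 1 - M"
  proof -
    have "(\<Sum>u\<in>V. \<delta> u) = (\<Sum>u\<in>{x, y}. \<delta> u)"
      using ne finite_V by (intro sum.mono_neutral_right) (auto simp: \<delta>_def)
    thus ?thesis using ne by (simp add: \<delta>_def M_def)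
  qed
  have res: "0 \<le> ?\<mu> u - \<delta> u" "0 \<le> ?\<nu> u - \<delta> u" "0 \<le> \<delta> u" for u
    using nonneg[of u] nonneg[of x] nonneg[of y] small_x small_y diag a by (auto simp: \<delta>_def)
  have coup: "coupling V ?\<mu> ?\<nu> \<pi>"
    unfolding coupling_def
  proof (intro conjI ballI)
    fix u v show "0 \<le> \<pi> u v" using res[of u] res[of v] M by (auto simp: \<pi>_def)
  next
    fix u assume u: "u \<in> V"
    have "(\<Sum>v\<in>V. \<pi> u v) = \<delta> u + (?\<mu> u - \<delta> u) * (\<Sum>v\<in>V. ?\<nu> v - \<delta> v) / M"
      using u finite_V by (simp add: \<pi>_def sum.distrib sum_divide_distrib sum_distrib_left)
    thus "(\<Sum>v\<in>V. \<pi> u v) = ?\<mu> u"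
      using M lazy_measure_mass[OF ne(3), of a] by (simp add: sum_subtractf sum\<delta>)
  next
    fix v assume v: "v \<in> V"
    have "(\<Sum>u\<in>V. \<pi> u v) = \<delta> v + (\<Sum>u\<in>V. ?\<mu> u - \<delta> u) * (?\<nu> v - \<delta> v) / M"
      using v finite_V by (simp add: \<pi>_def sum.distrib sum_divide_distrib sum_distrib_right)
    thus "(\<Sum>u\<in>V. \<pi> u v) = ?\<nu> v"
      using M lazy_measure_mass[OF ne(2), of a] by (simp add: sum_subtractf sum\<delta>)
  qed
  have tight: "\<pi> u v * ?d u v \<le> \<pi> u v * (f u - f v)" if "u \<in> V" "v \<in> V" for u v
  proof (cases "\<pi> u v = 0")
    case False
    have "?d u v \<le> f u - f v"
    proof (cases "u = v")
      case True
      thus ?thesis using path_metric_le[of u "[u]" u] by (simp add: gwalk_betw_def gwalk_def walk_length_def)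
    next
      case uv: False
      hence "?\<mu> u - \<delta> u \<noteq> 0" "?\<nu> v - \<delta> v \<noteq> 0" using False by (auto simp: \<pi>_def)
      \<comment> \<open>The remainders vanish for \<open>?\<mu>\<close> at \<open>y\<close> and for
        \<open>?\<nu>\<close> at \<open>x\<close>. Hence every charged pair off the diagonal is
        joined by a walk through \<open>x\<close> and then \<open>y\<close> along which
        \<open>f\<close> only descends.\<close>
      hence u: "u = x \<or> u \<in> nbrs x \<and> u \<noteq> y" and v: "v = y \<or> v \<in> nbrs y \<and> v \<noteq> x"
        using ne by (auto simp: \<delta>_def lazy_measure_def nbrs_def split: if_splits)
      show ?thesis using u v
      proof (elim disjE conjE)
        assume "u = x" "v = y"
        thus ?thesis using path_metric_le[of u "[x, y]" v] xy fxy
          by (simp add: gwalk_betw_def gwalk_def walk_length_def)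
      next
        assume "u = x" "v \<in> nbrs y" "v \<noteq> x"
        thus ?thesis using path_metric_le[of u "[x, y, v]" v] xy fxy fy[of v]
          by (simp add: gwalk_betw_def gwalk_def walk_length_def nbrs_def)
      next
        assume "u \<in> nbrs x" "u \<noteq> y" "v = y"
        thus ?thesis using path_metric_le[of u "[u, x, y]" v] xy fxy fx[of u]
          by (simp add: gwalk_betw_def gwalk_def walk_length_def nbrs_def insert_commute)
      next
        assume "u \<in> nbrs x" "u \<noteq> y" "v \<in> nbrs y" "v \<noteq> x"
        thus ?thesis using path_metric_le[of u "[u, x, y, v]" v] xy fxy fx[of u] fy[of v]
          by (simp add: gwalk_betw_def gwalk_def walk_length_def nbrs_def insert_commute)
      qed
    qed
    thus ?thesis using coup that by (auto simp: coupling_def intro!: mult_left_mono)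
  qed simp
  have "(\<Sum>u\<in>V. \<Sum>v\<in>V. \<pi> u v * ?d u v) \<le> ?R"
    unfolding val[symmetric] coupling_cost_potential[OF coup, of f, symmetric]
    by (intro sum_mono tight)
  hence "(\<Sum>u\<in>V. \<Sum>v\<in>V. \<pi> u v * ?d u v) = ?R" using lower[OF coup] by simp
  thus ?thesis unfolding wasserstein1_def
    using coup lower by (intro cInf_eq_minimum) (auto intro!: exI[of _ \<pi>])
qed

text \<open>By \<open>wasserstein_lazy\<close> the quotient does not depend on \<open>a\<close> once
  \<open>1 / 2 < a < 1\<close>, so the limit is its constant value there.\<close>

lemma lly_curvature_tree:
  assumes xy: "{x, y} \<in> E"
  shows "lly_curvature V E w x y
    = (2 - real (deg x)) / (w {x, y} * inv_weight_sum E w x)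
    + (2 - real (deg y)) / (w {x, y} * inv_weight_sum E w y)" (is "_ = ?k")
proof -
  have "\<forall>\<^sub>F a in at_left (1::real). a \<in> {1/2<..<1}"
    by (rule eventually_at_left_real) simp
  hence "\<forall>\<^sub>F a in at_left 1. ?k = (1 - wasserstein1 V (path_metric E w) (lazy_measure E w a x)
     (lazy_measure E w a y) / w {x, y}) / (1 - a)"
  proof eventually_elim
    case (elim a)
    have "w {x, y} \<noteq> 0" "1 - a \<noteq> 0" using w_pos[OF xy] elim by auto
    moreover have "inv_weight_sum E w x \<noteq> 0" "inv_weight_sum E w y \<noteq> 0"
      using inv_weight_sum_pos edgeD[OF xy] by (metis less_irrefl)+
    ultimately show ?case using elim by (simp add: wasserstein_lazy[OF xy] divide_simps) algebra
  qed
  hence "((\<lambda>a. (1 - wasserstein1 V (path_metric E w) (lazy_measure E w a x)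
     (lazy_measure E w a y) / w {x, y}) / (1 - a)) \<longlongrightarrow> ?k) (at_left 1)"
    by (rule tendsto_eventually[OF eventually_mono]) simp
  thus ?thesis unfolding lly_curvature_def by (intro tendsto_Lim) auto
qed

text \<open>The two ends of \<open>e\<close> are written as a conditional sum over all of
  \<open>V\<close> to match \<open>blend\<close>, where vertex and edge sums are exchanged.\<close>

lemma edge_curvature_tree:
  assumes e: "e \<in> E"
  shows "edge_curvature V E w e
    = (\<Sum>x\<in>V. if x \<in> e then (2 - real (deg x)) / (w e * inv_weight_sum E w x) else 0)"
proof -
  obtain x y where xy: "e = {x, y}" "x \<noteq> y" using e by (rule edgeE)
  have "edge_curvature V E w e = lly_curvature V E w x y"
    unfolding edge_curvature_def
  proof (rule the_equality)
    show "\<forall>x' y'. e = {x', y'} \<longrightarrow> lly_curvature V E w x y = lly_curvature V E w x' y'"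
    proof (intro allI impI)
      fix x' y' assume "e = {x', y'}"
      hence "x' = x \<and> y' = y \<or> x' = y \<and> y' = x" using xy by (auto simp: doubleton_eq_iff)
      moreover have "lly_curvature V E w x y = lly_curvature V E w y x"
        using e xy lly_curvature_tree[of x y] lly_curvature_tree[of y x] by (simp add: insert_commute)
      ultimately show "lly_curvature V E w x y = lly_curvature V E w x' y'" by metis
    qed
  qed (use xy in blast)
  also have "\<dots> = (\<Sum>x\<in>e. (2 - real (deg x)) / (w e * inv_weight_sum E w x))"
    using e xy by (simp add: lly_curvature_tree)
  also have "\<dots> = (\<Sum>x\<in>V. if x \<in> e then (2 - real (deg x)) / (w e * inv_weight_sum E w x) else 0)"
    using finite_V edge_subset[OF e] by (subst sum.inter_restrict[symmetric]) (auto intro!: sum.cong)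
  finally show ?thesis .
qed

end

end

section \<open>Gradient flows of convex functions\<close>

text \<open>At \<open>0\<close> the flow has only a one-sided derivative, and only continuity is
  used there; at positive times \<open>at t within {0..}\<close> is the full neighbourhood
  filter.\<close>

lemma antimono_within_nonneg:
  fixes f :: "real \<Rightarrow> real"
  assumes deriv: "\<And>t. 0 \<le> t \<Longrightarrow> (f has_real_derivative f' t) (at t within {0..})"
    and neg: "\<And>t. 0 < t \<Longrightarrow> t < b \<Longrightarrow> f' t \<le> 0"
    and ab: "0 \<le> a" "a \<le> b"
  shows "f b \<le> f a"
proof (rule DERIV_nonpos_imp_decreasing_open[OF ab(2)])
  fix x assume x: "a < x" "x < b"
  have "at x within {0..} = at x" using x ab by (intro at_within_interior) auto
  thus "\<exists>y. DERIV f x :> y \<and> y \<le> 0" using deriv[of x] neg[of x] x ab by auto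
next
  show "continuous_on {a..b} f"
    unfolding continuous_on_eq_continuous_within
  proof
    fix x assume "x \<in> {a..b}"
    hence "continuous (at x within {0..}) f"
      using DERIV_continuous[OF deriv[of x]] ab by simp
    thus "continuous (at x within {a..b}) f"
      by (rule continuous_within_subset) (use ab in auto)
  qed
qed

lemma has_real_derivative_shift_nonneg:
  fixes f :: "real \<Rightarrow> real"
  assumes "(f has_real_derivative D) (at (t + h) within {0..})" "0 \<le> h"
  shows "((\<lambda>s. f (s + h)) has_real_derivative D) (at t within {0..})"
proof -
  have "(f has_real_derivative D) (at (t + h) within (\<lambda>s. s + h) ` {0..})"
    by (rule DERIV_subset[OF assms(1)]) (use assms(2) in auto)
  moreover have "((\<lambda>s. s + h) has_real_derivative 1) (at t within {0..})"
    by (auto intro!: derivative_eq_intros)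
  ultimately have "((f \<circ> (\<lambda>s. s + h)) has_real_derivative D * 1) (at t within {0..})"
    by (rule DERIV_image_chain)
  thus ?thesis by (simp add: o_def)
qed

text \<open>\<open>G\<close> stands for the gradient of \<open>F\<close>. It is encoded by the
  subgradient inequality and by the decay of \<open>F\<close> along the curve, so no derivative in
  several variables appears.\<close>

locale convex_gradient_flow =
  fixes E :: "'e set" and F :: "('e \<Rightarrow> real) \<Rightarrow> real" and G :: "('e \<Rightarrow> real) \<Rightarrow> 'e \<Rightarrow> real"
    and \<theta> :: "real \<Rightarrow> 'e \<Rightarrow> real"
  assumes fin: "finite E"
    and convex: "\<And>x y. (\<Sum>e\<in>E. G x e * (y e - x e)) \<le> F y - F x"
    and flow: "\<And>t e. 0 \<le> t \<Longrightarrow> e \<in> E \<Longrightarrow>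
      ((\<lambda>s. \<theta> s e) has_real_derivative - G (\<theta> t) e) (at t within {0..})"
    and dissipation: "\<And>t. 0 \<le> t \<Longrightarrow>
      ((\<lambda>s. F (\<theta> s)) has_real_derivative - (\<Sum>e\<in>E. (G (\<theta> t) e)\<^sup>2)) (at t within {0..})"
begin

text \<open>The subgradient inequalities from \<open>x\<close> to \<open>y\<close> and from
  \<open>y\<close> to \<open>x\<close> are added.\<close>

lemma gradient_monotone: "0 \<le> (\<Sum>e\<in>E. (G x e - G y e) * (x e - y e))"
proof -
  have "(\<Sum>e\<in>E. (G x e - G y e) * (x e - y e))
      = - (\<Sum>e\<in>E. G x e * (y e - x e)) - (\<Sum>e\<in>E. G y e * (x e - y e))"
    by (simp add: sum_negf[symmetric] sum_subtractf[symmetric] algebra_simps)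
  thus ?thesis using convex[of x y] convex[of y x] by linarith
qed

text \<open>
  Two solutions never move apart; comparing the solution with its own shift by \<open>h \<rightarrow> 0\<close>
  shows that the speed decreases.
\<close>

lemma gradient_norm_antimono:
  assumes st: "0 \<le> s" "s \<le> t"
  shows "(\<Sum>e\<in>E. (G (\<theta> t) e)\<^sup>2) \<le> (\<Sum>e\<in>E. (G (\<theta> s) e)\<^sup>2)"
proof -
  define D where "D = (\<lambda>h t. \<Sum>e\<in>E. (\<theta> (t + h) e - \<theta> t e)\<^sup>2)"
  have D_anti: "D h t \<le> D h s" if h: "0 < h" for h
  proof (rule antimono_within_nonneg[OF _ _ st])
    fix u :: real assume u: "0 \<le> u"
    show "(D h has_real_derivative
        (\<Sum>e\<in>E. 2 * (\<theta> (u + h) e - \<theta> u e) * (- G (\<theta> (u + h)) e - - G (\<theta> u) e))) (at u within {0..})"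
      unfolding D_def
    proof (rule DERIV_sum)
      fix e assume e: "e \<in> E"
      have "((\<lambda>s. \<theta> (s + h) e) has_real_derivative - G (\<theta> (u + h)) e) (at u within {0..})"
        using has_real_derivative_shift_nonneg[OF flow[OF _ e]] u h by simp
      from DERIV_power[OF DERIV_diff[OF this flow[OF u e]], of 2]
      show "((\<lambda>t. (\<theta> (t + h) e - \<theta> t e)\<^sup>2) has_real_derivative
          2 * (\<theta> (u + h) e - \<theta> u e) * (- G (\<theta> (u + h)) e - - G (\<theta> u) e)) (at u within {0..})"
        by (simp add: algebra_simps)
    qed
  next
    fix u :: real assume "0 < u" "u < t"
    have "(\<Sum>e\<in>E. 2 * (\<theta> (u + h) e - \<theta> u e) * (- G (\<theta> (u + h)) e - - G (\<theta> u) e))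
        = - 2 * (\<Sum>e\<in>E. (G (\<theta> (u + h)) e - G (\<theta> u) e) * (\<theta> (u + h) e - \<theta> u e))"
      unfolding sum_distrib_left by (intro sum.cong refl) (simp add: algebra_simps)
    thus "(\<Sum>e\<in>E. 2 * (\<theta> (u + h) e - \<theta> u e) * (- G (\<theta> (u + h)) e - - G (\<theta> u) e)) \<le> 0"
      using gradient_monotone[of "\<theta> (u + h)" "\<theta> u"] by linarith
  qed
  have lim: "((\<lambda>h. D h t / h\<^sup>2) \<longlongrightarrow> (\<Sum>e\<in>E. (G (\<theta> t) e)\<^sup>2)) (at_right 0)" if t: "0 \<le> t" for t
  proof -
    have "((\<lambda>h. (\<theta> (t + h) e - \<theta> t e) / h) \<longlongrightarrow> - G (\<theta> t) e) (at_right 0)" if "e \<in> E" for e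
    proof -
      have "((\<lambda>s. \<theta> s e) has_real_derivative - G (\<theta> t) e) (at_right t)"
        by (rule DERIV_subset[OF flow[OF t that]]) (use t in auto)
      hence "((\<lambda>y. (\<theta> y e - \<theta> t e) / (y - t)) \<longlongrightarrow> - G (\<theta> t) e) (at_right t)"
        by (simp add: has_field_derivative_iff)
      hence "((\<lambda>h. (\<theta> (h + t) e - \<theta> t e) / (h + t - t)) \<longlongrightarrow> - G (\<theta> t) e) (at_right 0)"
        by (subst (asm) at_right_to_0) (simp add: filterlim_filtermap)
      thus ?thesis by (simp add: add.commute)
    qed
    hence "((\<lambda>h. \<Sum>e\<in>E. ((\<theta> (t + h) e - \<theta> t e) / h)\<^sup>2) \<longlongrightarrow> (\<Sum>e\<in>E. (- G (\<theta> t) e)\<^sup>2)) (at_right 0)"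
      by (intro tendsto_intros)
    thus ?thesis by (simp add: D_def power_divide sum_divide_distrib)
  qed
  show ?thesis
  proof (rule tendsto_le[OF _ lim lim])
    show "\<forall>\<^sub>F h in at_right 0. D h t / h\<^sup>2 \<le> D h s / h\<^sup>2"
      unfolding eventually_at_right_field
      using D_anti by (intro exI[of _ 1]) (auto intro: divide_right_mono)
  qed (use st in auto)
qed

text \<open>
  For every \<open>y\<close> the function \<open>t (F (\<theta> t) - F y) + |\<theta> t - y|\<^sup>2 / 2 + t\<^sup>2 |G (\<theta> T)|\<^sup>2 / 2\<close> decreases on
  \<open>[0, T]\<close>; at \<open>T\<close>, convexity and completing the square give the bound.
\<close>

lemma gradient_norm_bound:
  assumes T: "0 < T"
  shows "(\<Sum>e\<in>E. (G (\<theta> T) e)\<^sup>2) \<le> (\<Sum>e\<in>E. (G y e)\<^sup>2) + (\<Sum>e\<in>E. (\<theta> 0 e - y e)\<^sup>2) / T\<^sup>2"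
proof -
  define N where "N t = (\<Sum>e\<in>E. (G (\<theta> t) e)\<^sup>2)" for t
  define S where "S = (\<lambda>t. \<Sum>e\<in>E. (\<theta> t e - y e)\<^sup>2)"
  define H where "H = (\<lambda>t. t * (F (\<theta> t) - F y) + S t / 2 + t\<^sup>2 * N T / 2)"
  have "H T \<le> H 0"
  proof (rule antimono_within_nonneg[where f = H])
    fix t :: real assume t: "0 \<le> t"
    have "(S has_real_derivative (\<Sum>e\<in>E. 2 * (\<theta> t e - y e) * - G (\<theta> t) e)) (at t within {0..})"
      unfolding S_def
    proof (rule DERIV_sum)
      fix e assume e: "e \<in> E"
      from DERIV_power[OF DERIV_diff[OF flow[OF t e] DERIV_const[of "y e"]], of 2]
      show "((\<lambda>t. (\<theta> t e - y e)\<^sup>2) has_real_derivative 2 * (\<theta> t e - y e) * - G (\<theta> t) e)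
          (at t within {0..})"
        by (simp add: algebra_simps)
    qed
    moreover have "(\<Sum>e\<in>E. 2 * (\<theta> t e - y e) * - G (\<theta> t) e)
        = - 2 * (\<Sum>e\<in>E. G (\<theta> t) e * (\<theta> t e - y e))"
      unfolding sum_distrib_left by (intro sum.cong refl) (simp add: algebra_simps)
    ultimately have S': "(S has_real_derivative - 2 * (\<Sum>e\<in>E. G (\<theta> t) e * (\<theta> t e - y e)))
        (at t within {0..})" by simp
    show "(H has_real_derivative (F (\<theta> t) - F y) - t * N t
        - (\<Sum>e\<in>E. G (\<theta> t) e * (\<theta> t e - y e)) + t * N T) (at t within {0..})"
      unfolding H_def
      by (rule derivative_eq_intros S' dissipation t refl | simp)+
        (simp add: N_def mult.commute)
  next
    fix t :: real assume t: "0 < t" "t < T"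
    have "t * N T \<le> t * N t"
      using gradient_norm_antimono[of t T] t by (simp add: N_def)
    moreover have "F (\<theta> t) - F y \<le> (\<Sum>e\<in>E. G (\<theta> t) e * (\<theta> t e - y e))"
      using convex[of "\<theta> t" y] by (simp add: right_diff_distrib sum_subtractf)
    ultimately show "(F (\<theta> t) - F y) - t * N t
        - (\<Sum>e\<in>E. G (\<theta> t) e * (\<theta> t e - y e)) + t * N T \<le> 0" by linarith
  qed (use T in auto)
  hence "T * (F (\<theta> T) - F y) + S T / 2 + T\<^sup>2 * N T / 2 \<le> S 0 / 2" by (simp add: H_def)
  moreover have "T * (\<Sum>e\<in>E. G y e * (\<theta> T e - y e)) \<le> T * (F (\<theta> T) - F y)"
    using convex[where x = y and y = "\<theta> T"] T by simp
  moreover have "0 \<le> (\<Sum>e\<in>E. (\<theta> T e - y e + T * G y e)\<^sup>2)" by (intro sum_nonneg) simp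
  moreover have "(\<Sum>e\<in>E. (\<theta> T e - y e + T * G y e)\<^sup>2)
      = S T + 2 * (T * (\<Sum>e\<in>E. G y e * (\<theta> T e - y e))) + T\<^sup>2 * (\<Sum>e\<in>E. (G y e)\<^sup>2)"
    by (simp add: S_def sum_distrib_left sum.distrib[symmetric] power2_eq_square algebra_simps)
  ultimately have "T\<^sup>2 * N T \<le> T\<^sup>2 * (\<Sum>e\<in>E. (G y e)\<^sup>2) + S 0" by linarith
  thus ?thesis using T by (simp add: N_def S_def field_simps)
qed

text \<open>The hypotheses say that \<open>p\<close> is the least-norm point of the closure of the
  range of \<open>G\<close>. By \<open>var\<close> the excess of the squared norm bounds the squared
  distance to \<open>p\<close>; \<open>gradient_norm_bound\<close> against a nearly optimal
  \<open>y\<close> makes that excess small.\<close>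

lemma gradient_converges:
  assumes var: "\<And>x. (\<Sum>e\<in>E. (p e)\<^sup>2) \<le> (\<Sum>e\<in>E. p e * G x e)"
    and approx: "\<And>\<epsilon>. 0 < \<epsilon> \<Longrightarrow> \<exists>y. (\<Sum>e\<in>E. (G y e)\<^sup>2) \<le> (\<Sum>e\<in>E. (p e)\<^sup>2) + \<epsilon>"
    and e: "e \<in> E"
  shows "((\<lambda>t. G (\<theta> t) e) \<longlongrightarrow> p e) at_top"
proof -
  have dist: "(G x e - p e)\<^sup>2 \<le> (\<Sum>e\<in>E. (G x e)\<^sup>2) - (\<Sum>e\<in>E. (p e)\<^sup>2)" for x
  proof -
    have "(G x e - p e)\<^sup>2 \<le> (\<Sum>e\<in>E. (G x e - p e)\<^sup>2)"
      using member_le_sum[OF e, of "\<lambda>e. (G x e - p e)\<^sup>2"] fin by simp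
    also have "\<dots> = (\<Sum>e\<in>E. (G x e)\<^sup>2) - 2 * (\<Sum>e\<in>E. p e * G x e) + (\<Sum>e\<in>E. (p e)\<^sup>2)"
      by (simp add: power2_diff sum.distrib sum_subtractf sum_distrib_left mult_ac)
    finally show ?thesis using var[of x] by linarith
  qed
  have "((\<lambda>t. (G (\<theta> t) e - p e)\<^sup>2) \<longlongrightarrow> 0) at_top"
  proof (rule tendstoI)
    fix \<epsilon> :: real assume \<epsilon>: "0 < \<epsilon>"
    then obtain y where y: "(\<Sum>e\<in>E. (G y e)\<^sup>2) \<le> (\<Sum>e\<in>E. (p e)\<^sup>2) + \<epsilon> / 2"
      using approx[of "\<epsilon> / 2"] by auto
    have "((\<lambda>t. (\<Sum>e\<in>E. (\<theta> 0 e - y e)\<^sup>2) / t\<^sup>2) \<longlongrightarrow> 0) at_top"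
      by (intro tendsto_divide_0[OF tendsto_const] filterlim_at_top_imp_at_infinity
          filterlim_pow_at_top filterlim_ident) simp
    hence "\<forall>\<^sub>F t in at_top. (\<Sum>e\<in>E. (\<theta> 0 e - y e)\<^sup>2) / t\<^sup>2 < \<epsilon> / 2"
      using \<epsilon> by (intro order_tendstoD(2)) auto
    moreover have "\<forall>\<^sub>F t in at_top. (0 :: real) < t" by (rule eventually_gt_at_top)
    ultimately show "\<forall>\<^sub>F t in at_top. dist ((G (\<theta> t) e - p e)\<^sup>2) 0 < \<epsilon>"
    proof eventually_elim
      case (elim t)
      have "(G (\<theta> t) e - p e)\<^sup>2 < \<epsilon>"
        using dist[of "\<theta> t"] gradient_norm_bound[OF elim(2), of y] y elim(1) by linarith
      thus ?case by simp
    qed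
  qed
  hence "((\<lambda>t. sqrt ((G (\<theta> t) e - p e)\<^sup>2)) \<longlongrightarrow> sqrt 0) at_top" by (rule tendsto_real_sqrt)
  hence "((\<lambda>t. \<bar>G (\<theta> t) e - p e\<bar>) \<longlongrightarrow> 0) at_top" by simp
  thus ?thesis by (simp add: tendsto_rabs_zero_iff LIM_zero_iff)
qed

end

section \<open>Points of the base polytope that are tight on their level sets\<close>

text \<open>Abel summation along the level sets of \<open>p\<close>, one level per induction step.\<close>

lemma sum_gap_level_nonpos:
  fixes p g :: "'e \<Rightarrow> real"
  assumes "finite S" "\<And>e. e \<in> S \<Longrightarrow> p e \<le> M"
    and "\<And>t. (\<Sum>e | e \<in> S \<and> p e \<le> t. g e) \<le> 0"
  shows "(\<Sum>e\<in>S. (M - p e) * g e) \<le> 0"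
  using assms
proof (induction S arbitrary: M rule: finite_psubset_induct)
  case (psubset S)
  show ?case
  proof (cases "S = {}")
    case False
    define m where "m = Max (p ` S)"
    define S' where "S' = {e \<in> S. p e < m}"
    have le_m: "p e \<le> m" if "e \<in> S" for e using that psubset.hyps by (simp add: m_def)
    have "m \<in> p ` S" using False psubset.hyps by (simp add: m_def)
    then obtain e0 where e0: "e0 \<in> S" "p e0 = m" by auto
    have sub: "S' \<subset> S" using e0 by (auto simp: S'_def)
    have fin': "finite S'" using psubset.hyps by (simp add: S'_def)
    have "(\<Sum>e\<in>S'. (m - p e) * g e) \<le> 0"
    proof (rule psubset.IH[OF sub])
      fix t
      show "(\<Sum>e | e \<in> S' \<and> p e \<le> t. g e) \<le> 0"
      proof (cases "S' = {}")
        case S': False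
        \<comment> \<open>Capping \<open>t\<close> at the largest value on \<open>S'\<close> keeps
          the removed top level out, so a level set of \<open>S'\<close> is again one of
          \<open>S\<close>.\<close>
        define t' where "t' = min t (Max (p ` S'))"
        have "{e. e \<in> S' \<and> p e \<le> t} = {e. e \<in> S \<and> p e \<le> t'}"
        proof (intro set_eqI iffI; clarify)
          fix e assume "e \<in> S'" "p e \<le> t"
          thus "e \<in> S \<and> p e \<le> t'" using fin' sub by (auto simp: t'_def)
        next
          fix e assume e: "e \<in> S" "p e \<le> t'"
          have "Max (p ` S') \<in> p ` S'" using S' fin' by simp
          hence "t' < m" by (auto simp: S'_def t'_def min_less_iff_disj)
          thus "e \<in> S' \<and> p e \<le> t" using e by (auto simp: S'_def t'_def)
        qed
        thus ?thesis using psubset.prems(2)[of t'] by simp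
      qed simp
    qed (auto simp: S'_def)
    moreover have "(\<Sum>e\<in>S. (m - p e) * g e) = (\<Sum>e\<in>S'. (m - p e) * g e)"
      using psubset.hyps sub le_m
      by (intro sum.mono_neutral_right) (auto simp: S'_def less_le)
    moreover have "(M - m) * (\<Sum>e\<in>S. g e) \<le> 0"
    proof -
      have "{e. e \<in> S \<and> p e \<le> m} = S" using le_m by auto
      hence "(\<Sum>e\<in>S. g e) \<le> 0" using psubset.prems(2)[of m] by simp
      moreover have "m \<le> M" using psubset.prems(1)[OF e0(1)] e0(2) by simp
      ultimately show ?thesis by (simp add: mult_nonneg_nonpos)
    qed
    moreover have "(\<Sum>e\<in>S. (M - p e) * g e) = (M - m) * (\<Sum>e\<in>S. g e) + (\<Sum>e\<in>S. (m - p e) * g e)"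
      unfolding sum_distrib_left sum.distrib[symmetric] by (intro sum.cong refl) (simp add: algebra_simps)
    ultimately show ?thesis by simp
  qed simp
qed

text \<open>With \<open>M\<close> above all values of \<open>p\<close>, the inequality for
  \<open>M - p\<close> turns into one for \<open>p\<close> because the total of \<open>g\<close> is
  zero.\<close>

lemma sum_weighted_level_nonneg:
  fixes p g :: "'e \<Rightarrow> real"
  assumes fin: "finite S" and level: "\<And>t. (\<Sum>e | e \<in> S \<and> p e \<le> t. g e) \<le> 0"
    and total: "(\<Sum>e\<in>S. g e) = 0"
  shows "0 \<le> (\<Sum>e\<in>S. p e * g e)"
proof -
  \<comment> \<open>Inserting \<open>0\<close> gives the maximum a meaning when \<open>S\<close> is
    empty; any upper bound of \<open>p\<close> on \<open>S\<close> would do.\<close>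
  define M where "M = Max (insert 0 (p ` S))"
  have "(\<Sum>e\<in>S. (M - p e) * g e) \<le> 0"
    using fin by (intro sum_gap_level_nonpos[OF fin _ level]) (simp add: M_def)
  moreover have "(\<Sum>e\<in>S. (M - p e) * g e) = M * (\<Sum>e\<in>S. g e) - (\<Sum>e\<in>S. p e * g e)"
    unfolding sum_distrib_left sum_subtractf[symmetric] by (intro sum.cong refl) (simp add: algebra_simps)
  ultimately show ?thesis using total by simp
qed

text \<open>Optimality conditions for the minimum-norm point of a base polytope: all its sublevel
  sets are tight.\<close>

locale tight_base =
  fixes E :: "'e set" and f :: "'e set \<Rightarrow> real" and c :: "'e \<Rightarrow> real"
  assumes fin: "finite E" and f_empty: "f {} = 0"
    and base: "c \<in> base_polytope E f"
    and tight: "f {e \<in> E. c e \<le> t} = (\<Sum>e | e \<in> E \<and> c e \<le> t. c e)"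
begin

lemma sum_le: "B \<subseteq> E \<Longrightarrow> sum c B \<le> f B" and sum_total: "sum c E = f E"
  using base by (auto simp: base_polytope_def)

text \<open>On sublevel sets of \<open>c\<close> the sum of \<open>z\<close> is at most that of
  \<open>c\<close>, and the totals agree, so \<open>z - c\<close> has nonnegative inner product with
  \<open>c\<close>. Keeping the squared distance on the left yields uniqueness of the minimizer as
  well.\<close>

lemma min_norm_base:
  assumes z: "z \<in> base_polytope E f"
  shows "(\<Sum>e\<in>E. (z e - c e)\<^sup>2) \<le> (\<Sum>e\<in>E. (z e)\<^sup>2) - (\<Sum>e\<in>E. (c e)\<^sup>2)"
proof -
  have "0 \<le> (\<Sum>e\<in>E. c e * (z e - c e))"
  proof (rule sum_weighted_level_nonneg[OF fin])
    fix t
    have "sum z {e \<in> E. c e \<le> t} \<le> f {e \<in> E. c e \<le> t}"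
      using z by (simp add: base_polytope_def)
    thus "(\<Sum>e | e \<in> E \<and> c e \<le> t. z e - c e) \<le> 0" by (simp add: sum_subtractf tight)
    show "(\<Sum>e\<in>E. z e - c e) = 0" using z sum_total by (simp add: sum_subtractf base_polytope_def)
  qed
  moreover have "(\<Sum>e\<in>E. (z e - c e)\<^sup>2)
      = (\<Sum>e\<in>E. (z e)\<^sup>2) - (\<Sum>e\<in>E. (c e)\<^sup>2) - 2 * (\<Sum>e\<in>E. c e * (z e - c e))"
    unfolding sum_distrib_left sum_subtractf[symmetric]
    by (intro sum.cong refl) (simp add: power2_eq_square algebra_simps)
  ultimately show ?thesis by linarith
qed

lemma is_arg_min_norm_iff:
  "is_arg_min (\<lambda>z. 1 / 2 * (\<Sum>e\<in>E. (z e)\<^sup>2)) (\<lambda>z. z \<in> base_polytope E f) z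
    \<longleftrightarrow> (\<forall>e\<in>E. z e = c e)" (is "?min \<longleftrightarrow> _")
proof
  assume min: ?min
  hence z: "z \<in> base_polytope E f" by (simp add: is_arg_min_def)
  have "\<not> (\<Sum>e\<in>E. (c e)\<^sup>2) < (\<Sum>e\<in>E. (z e)\<^sup>2)" using min base by (auto simp: is_arg_min_def)
  hence "(\<Sum>e\<in>E. (z e - c e)\<^sup>2) \<le> 0" using min_norm_base[OF z] by linarith
  moreover have "0 \<le> (\<Sum>e\<in>E. (z e - c e)\<^sup>2)" by (intro sum_nonneg) simp
  ultimately have "(\<Sum>e\<in>E. (z e - c e)\<^sup>2) = 0" by linarith
  thus "\<forall>e\<in>E. z e = c e" using fin by (simp add: sum_nonneg_eq_0_iff)
next
  assume eq: "\<forall>e\<in>E. z e = c e"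
  have sums: "sum z B = sum c B" if "B \<subseteq> E" for B using eq that by (intro sum.cong) auto
  have "z \<in> base_polytope E f" using base sums by (simp add: base_polytope_def)
  moreover have "(\<Sum>e\<in>E. (z e)\<^sup>2) = (\<Sum>e\<in>E. (c e)\<^sup>2)" using eq by (intro sum.cong) auto
  moreover have "(\<Sum>e\<in>E. (c e)\<^sup>2) \<le> (\<Sum>e\<in>E. (y e)\<^sup>2)" if "y \<in> base_polytope E f" for y
  proof -
    have "0 \<le> (\<Sum>e\<in>E. (y e - c e)\<^sup>2)" by (intro sum_nonneg) simp
    thus ?thesis using min_norm_base[OF that] by linarith
  qed
  ultimately show ?min by (auto simp: is_arg_min_def not_less)
qed

text \<open>\<open>sum c\<close> is at most \<open>f\<close>, with equality at \<open>B\<close>, and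
  each element beyond \<open>B\<close> adds at least \<open>a\<close> to it. So slopes are at least
  \<open>a\<close>, and slope \<open>a\<close> forces \<open>c = a\<close> on \<open>C - B\<close>,
  hence \<open>C \<subseteq> L\<close>. Tightness of \<open>L\<close> shows that \<open>a\<close> is
  attained.\<close>

lemma slope_level:
  assumes B: "B \<subseteq> E" "f B = sum c B" and above: "\<And>e. e \<in> E - B \<Longrightarrow> a \<le> c e"
    and a: "a \<in> c ` (E - B)" and level: "L = {e \<in> E. c e \<le> a}" and BL: "B \<subseteq> L"
  shows "a = (MIN C\<in>{C. B \<subset> C \<and> C \<subseteq> E}. slope f B C)"
    and "unique_largest_minimizer (slope f B) {C. B \<subset> C \<and> C \<subseteq> E} L"
proof -
  let ?F = "{C. B \<subset> C \<and> C \<subseteq> E}"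
  have finC: "finite C" if "C \<subseteq> E" for C using that fin finite_subset by auto
  have key: "a \<le> slope f B C \<and> (slope f B C = a \<longrightarrow> C \<subseteq> L)" if C: "C \<in> ?F" for C
  proof -
    have CB: "B \<subset> C" "C \<subseteq> E" using C by auto
    have card: "real (card C) - real (card B) = real (card (C - B))" "card B < card C"
      using CB finC card_Diff_subset[of B C] psubset_card_mono[of C B] by (auto simp: of_nat_diff)
    have diff: "sum c C - sum c B = sum c (C - B)"
      using CB finC by (simp add: sum_diff psubset_imp_subset)
    have excess: "(\<Sum>e\<in>C - B. c e - a) \<le> f C - f B - a * (real (card C) - real (card B))"
      using sum_le[OF CB(2)] B(2) diff card(1) by (simp add: sum_subtractf)
    have nonneg: "0 \<le> c e - a" if "e \<in> C - B" for e using above[of e] that CB by auto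
    have "0 \<le> (\<Sum>e\<in>C - B. c e - a)" using nonneg by (rule sum_nonneg)
    hence "a \<le> slope f B C" using excess card(2) by (simp add: slope_def field_simps)
    moreover have "C \<subseteq> L" if "slope f B C = a"
    proof -
      have "f C - f B - a * (real (card C) - real (card B)) = 0"
        using that card(2) by (simp add: slope_def field_simps)
      hence "(\<Sum>e\<in>C - B. c e - a) = 0" using excess \<open>0 \<le> (\<Sum>e\<in>C - B. c e - a)\<close> by linarith
      hence "\<forall>e\<in>C - B. c e - a = 0"
        using nonneg finC[OF CB(2)] by (subst (asm) sum_nonneg_eq_0_iff) auto
      thus "C \<subseteq> L" using CB BL by (auto simp: level)
    qed
    ultimately show ?thesis by blast
  qed
  have LF: "L \<in> ?F" using a BL by (auto simp: level)
  have slopeL: "slope f B L = a"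
  proof -
    have "sum c L - sum c B = sum c (L - B)"
      using BL finC[of L] LF by (simp add: sum_diff)
    also have "\<dots> = (\<Sum>e\<in>L - B. a)"
      using above by (intro sum.cong) (auto simp: level intro: antisym)
    also have "\<dots> = a * (real (card L) - real (card B))"
      using BL finC[of L] finC[of B] B(1) LF by (simp add: card_Diff_subset of_nat_diff card_mono)
    finally have "f L - f B = a * (real (card L) - real (card B))"
      using B(2) tight[of a] by (simp add: level)
    moreover have "card B < card L" using LF finC[of L] by (auto intro: psubset_card_mono)
    ultimately show ?thesis by (simp add: slope_def)
  qed
  have "finite ?F" using fin by (intro finite_subset[of ?F "Pow E"]) auto
  have "Min (slope f B ` ?F) = a"
  proof (rule Min_eqI)
    show "finite (slope f B ` ?F)" using \<open>finite ?F\<close> by (rule finite_imageI)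
    show "a \<in> slope f B ` ?F" using LF slopeL by (metis imageI)
  qed (use key in blast)
  thus "a = (MIN C\<in>?F. slope f B C)" by (rule sym)
  show "unique_largest_minimizer (slope f B) ?F L"
    unfolding unique_largest_minimizer_def is_arg_min_linorder
  proof (intro conjI allI impI)
    fix C assume C: "C \<in> ?F \<and> (\<forall>y. y \<in> ?F \<longrightarrow> slope f B C \<le> slope f B y)"
    hence "slope f B C \<le> a" using LF slopeL by metis
    thus "C \<subseteq> L" using key[of C] C by auto
  next
    show "slope f B L \<le> slope f B C" if "C \<in> ?F" for C
      using key[OF that] slopeL by simp
  qed (rule LF)
qed

end

text \<open>Needed because the limit vector and the given \<open>c\<close> are known to agree on
  \<open>E\<close> only.\<close>

lemma tight_base_cong:
  assumes "tight_base E f c" and eq: "\<And>e. e \<in> E \<Longrightarrow> d e = c e"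
  shows "tight_base E f d"
proof -
  interpret tight_base E f c by fact
  have sums: "sum d B = sum c B" if "B \<subseteq> E" for B using eq that by (intro sum.cong) auto
  have levels: "{e \<in> E. d e \<le> t} = {e \<in> E. c e \<le> t}" for t using eq by auto
  have "sum d {e \<in> E. c e \<le> t} = sum c {e \<in> E. c e \<le> t}" for t by (rule sums) auto
  thus ?thesis
    using fin f_empty base tight sums by unfold_locales (simp_all add: base_polytope_def levels)
qed

section \<open>Minimizers of the average density\<close>

lemma unique_largest_minimizer_unique:
  "unique_largest_minimizer f \<F> M \<Longrightarrow> unique_largest_minimizer f \<F> N \<Longrightarrow> M = N"
  unfolding unique_largest_minimizer_def by blast

lemma slope_empty: "f {} = 0 \<Longrightarrow> slope f {} = avg_density f"
  by (simp add: slope_def avg_density_def fun_eq_iff)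

text \<open>Clearing the denominator turns minimality of a ratio into an additive condition, to
  which submodularity applies.\<close>

lemma min_density_iff:
  fixes f :: "'e set \<Rightarrow> real"
  assumes fin: "finite E" and a: "a = (MIN B\<in>{B. B \<noteq> {} \<and> B \<subseteq> E}. avg_density f B)" and ne: "E \<noteq> {}"
  shows "is_arg_min (avg_density f) (\<lambda>B. B \<noteq> {} \<and> B \<subseteq> E) B
      \<longleftrightarrow> B \<noteq> {} \<and> B \<subseteq> E \<and> f B = a * real (card B)"
    and "B \<subseteq> E \<Longrightarrow> B \<noteq> {} \<Longrightarrow> a * real (card B) \<le> f B"
proof -
  let ?S = "{B. B \<noteq> {} \<and> B \<subseteq> E}"
  have finS: "finite ?S" using fin by simp
  have pos: "real (card B) > 0" if "B \<in> ?S" for B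
    using that fin by (auto simp: card_gt_0_iff finite_subset)
  have le: "a \<le> avg_density f B" if "B \<in> ?S" for B
    unfolding a using that finS by (intro Min_le) auto
  show "a * real (card B) \<le> f B" if "B \<subseteq> E" "B \<noteq> {}" for B
    using le[of B] pos[of B] that by (simp add: avg_density_def field_simps)
  have "a \<in> avg_density f ` ?S" unfolding a using finS ne by (intro Min_in) auto
  then obtain C where C: "C \<in> ?S" "avg_density f C = a" by auto
  have "is_arg_min (avg_density f) (\<lambda>B. B \<noteq> {} \<and> B \<subseteq> E) B \<longleftrightarrow> B \<in> ?S \<and> avg_density f B = a"
  proof
    assume B: "is_arg_min (avg_density f) (\<lambda>B. B \<noteq> {} \<and> B \<subseteq> E) B"
    hence "B \<in> ?S" "avg_density f B \<le> avg_density f C"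
      using C(1) by (simp_all add: is_arg_min_linorder)
    thus "B \<in> ?S \<and> avg_density f B = a" using le[of B] C(2) by auto
  next
    assume "B \<in> ?S \<and> avg_density f B = a"
    thus "is_arg_min (avg_density f) (\<lambda>B. B \<noteq> {} \<and> B \<subseteq> E) B"
      using le by (simp add: is_arg_min_linorder)
  qed
  also have "\<dots> \<longleftrightarrow> B \<in> ?S \<and> f B = a * real (card B)"
  proof (cases "B \<in> ?S")
    case True
    with pos[OF True] show ?thesis by (simp add: avg_density_def divide_eq_eq)
  qed blast
  finally show "is_arg_min (avg_density f) (\<lambda>B. B \<noteq> {} \<and> B \<subseteq> E) B
      \<longleftrightarrow> B \<noteq> {} \<and> B \<subseteq> E \<and> f B = a * real (card B)" by simp
qed

text \<open>Subtracting \<open>a * card\<close> leaves a submodular function that is nonnegative on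
  subsets of \<open>E\<close> and zero at \<open>B\<close> and \<open>C\<close>. Its values at the
  union and the intersection are nonnegative with sum at most zero, so both vanish.\<close>

lemma min_density_lattice:
  fixes f :: "'e set \<Rightarrow> real"
  assumes fin: "finite E" and sub: "submodular_on E f" and f0: "f {} = 0"
    and B: "is_arg_min (avg_density f) (\<lambda>B. B \<noteq> {} \<and> B \<subseteq> E) B"
    and C: "is_arg_min (avg_density f) (\<lambda>B. B \<noteq> {} \<and> B \<subseteq> E) C"
  shows "is_arg_min (avg_density f) (\<lambda>B. B \<noteq> {} \<and> B \<subseteq> E) (B \<union> C)"
    and "B \<inter> C \<noteq> {} \<Longrightarrow> is_arg_min (avg_density f) (\<lambda>B. B \<noteq> {} \<and> B \<subseteq> E) (B \<inter> C)"
proof -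
  define a where "a = (MIN B\<in>{B. B \<noteq> {} \<and> B \<subseteq> E}. avg_density f B)"
  have ne: "E \<noteq> {}" using B by (auto simp: is_arg_min_def)
  note iff = min_density_iff(1)[OF fin a_def ne] and ge = min_density_iff(2)[OF fin a_def ne]
  have BC: "B \<noteq> {}" "B \<subseteq> E" "f B = a * real (card B)" "C \<subseteq> E" "f C = a * real (card C)"
    using B C iff by auto
  have fins: "finite B" "finite C" using BC fin by (auto intro: finite_subset)
  have "f (B \<union> C) + f (B \<inter> C) \<le> f B + f C" using sub BC(2,4) unfolding submodular_on_def by blast
  also have "\<dots> = a * (real (card B) + real (card C))" using BC by (simp add: algebra_simps)
  also have "real (card B) + real (card C) = real (card (B \<union> C)) + real (card (B \<inter> C))"
    using card_Un_Int[OF fins] by linarith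
  finally have le: "f (B \<union> C) + f (B \<inter> C) \<le> a * real (card (B \<union> C)) + a * real (card (B \<inter> C))"
    by (simp add: algebra_simps)
  have un: "a * real (card (B \<union> C)) \<le> f (B \<union> C)" using ge[of "B \<union> C"] BC by auto
  have int: "a * real (card (B \<inter> C)) \<le> f (B \<inter> C)"
    using ge[of "B \<inter> C"] BC f0 by (cases "B \<inter> C = {}") auto
  show "is_arg_min (avg_density f) (\<lambda>B. B \<noteq> {} \<and> B \<subseteq> E) (B \<union> C)"
    unfolding iff using le un int BC by auto
  show "is_arg_min (avg_density f) (\<lambda>B. B \<noteq> {} \<and> B \<subseteq> E) (B \<inter> C)" if "B \<inter> C \<noteq> {}"
    unfolding iff using le un int BC that by auto
qed

section \<open>Limit of the curvature\<close>

text \<open>Tychonoff's theorem, transferred to the topology on functions.\<close>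

lemma compact_coordinatewise:
  fixes S :: "'i \<Rightarrow> 'b::topological_space set"
  assumes "\<And>i. compact (S i)"
  shows "compact {f. \<forall>i. f i \<in> S i}"
proof -
  have "compactin (product_topology (\<lambda>i. euclidean) UNIV) (PiE UNIV S)"
    using assms by (simp add: compactin_PiE)
  moreover have "PiE UNIV S = {f. \<forall>i. f i \<in> S i}" by (auto simp: PiE_def)
  ultimately show ?thesis by (simp add: euclidean_product_topology)
qed

text \<open>The subgradient inequality of log-sum-exp. With softmax weights \<open>r\<close> and
  \<open>m\<close> the weighted mean of \<open>a - b\<close>, averaging
  \<open>1 + t \<le> exp t\<close> over the centred differences gives
  \<open>1 \<le> B / A * exp (- m)\<close>.\<close>

lemma ln_sum_exp_gradient_le:
  fixes a b :: "'i \<Rightarrow> real"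
  assumes I: "finite I" "I \<noteq> {}"
  shows "(\<Sum>i\<in>I. exp (- a i) / (\<Sum>j\<in>I. exp (- a j)) * (a i - b i))
    \<le> ln (\<Sum>j\<in>I. exp (- b j)) - ln (\<Sum>j\<in>I. exp (- a j))"
proof -
  define A where "A = (\<Sum>j\<in>I. exp (- a j))"
  define B where "B = (\<Sum>j\<in>I. exp (- b j))"
  define r where "r i = exp (- a i) / A" for i
  define m where "m = (\<Sum>i\<in>I. r i * (a i - b i))"
  have pos: "A > 0" "B > 0" using I by (auto simp: A_def B_def intro!: sum_pos)
  have r: "0 \<le> r i" for i using pos by (simp add: r_def)
  have r1: "(\<Sum>i\<in>I. r i) = 1"
    using pos by (simp add: r_def sum_divide_distrib[symmetric] A_def)
  have "1 = (\<Sum>i\<in>I. r i * (1 + (a i - b i - m)))"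
  proof -
    have "(\<Sum>i\<in>I. r i * (1 + (a i - b i - m))) = (1 - m) * (\<Sum>i\<in>I. r i) + m"
      unfolding m_def[symmetric] sum_distrib_left
      by (subst (2) m_def) (simp add: sum.distrib[symmetric] algebra_simps)
    thus ?thesis by (simp add: r1)
  qed
  also have "\<dots> \<le> (\<Sum>i\<in>I. r i * exp (a i - b i - m))"
    by (intro sum_mono mult_left_mono exp_ge_add_one_self r)
  also have "\<dots> = (\<Sum>i\<in>I. exp (- b i) * (exp (- m) / A))"
    by (intro sum.cong refl) (simp add: r_def exp_add[symmetric] algebra_simps)
  also have "\<dots> = B / A * exp (- m)"
    unfolding sum_distrib_right[symmetric] B_def[symmetric] by simp
  finally have "exp m \<le> B / A" using pos by (simp add: exp_minus field_simps)
  hence "m \<le> ln (B / A)" using pos by (simp add: ln_ge_iff)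
  thus ?thesis using pos by (simp add: ln_div m_def r_def A_def B_def)
qed

lemma continuous_on_coordinate2:
  "continuous_on S (\<lambda>q :: 'i \<Rightarrow> 'j \<Rightarrow> 'b::topological_space. q i j)"
  using continuous_on_product_then_coordinatewise[OF continuous_on_product_coordinates]
  by (rule continuous_on_subset) simp

context nontrivial_tree
begin

text \<open>The softmax of \<open>- \<theta>\<close> on the star of \<open>x\<close>. For
  \<open>\<theta> = ln w\<close> it is the jump distribution at \<open>x\<close>, with entries
  \<open>1 / (w e * inv_weight_sum E w x)\<close>.\<close>

definition share :: "('a set \<Rightarrow> real) \<Rightarrow> 'a \<Rightarrow> 'a set \<Rightarrow> real" where
  "share \<theta> x e =
     (if e \<in> incident E x then exp (- \<theta> e) / (\<Sum>f\<in>incident E x. exp (- \<theta> f)) else 0)"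

text \<open>One probability vector on each star; the prescribed zeros elsewhere make the set
  compact.\<close>

definition shares :: "('a \<Rightarrow> 'a set \<Rightarrow> real) set" where
  "shares = {q. (\<forall>x e. 0 \<le> q x e) \<and> (\<forall>x e. e \<notin> incident E x \<longrightarrow> q x e = 0)
     \<and> (\<forall>x\<in>V. (\<Sum>e\<in>incident E x. q x e) = 1)}"

definition blend :: "('a \<Rightarrow> 'a set \<Rightarrow> real) \<Rightarrow> 'a set \<Rightarrow> real" where
  "blend q e = (\<Sum>x\<in>V. (2 - real (deg x)) * q x e)"

text \<open>The curvature as a function of the logarithms \<open>\<theta>\<close> of the weights.\<close>

abbreviation log_curvature :: "('a set \<Rightarrow> real) \<Rightarrow> 'a set \<Rightarrow> real" where
  "log_curvature \<theta> \<equiv> blend (share \<theta>)"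

text \<open>The convex function whose gradient in \<open>\<theta>\<close> is
  \<open>log_curvature\<close>.\<close>

definition potential :: "('a set \<Rightarrow> real) \<Rightarrow> real" where
  "potential \<theta> = (\<Sum>x\<in>V. (real (deg x) - 2) * ln (\<Sum>f\<in>incident E x. exp (- \<theta> f)))"

section \<open>Curvature expressed through vertex distributions\<close>

lemma incident_subset: "incident E x \<subseteq> E" by (auto simp: incident_def)

lemma partition_pos: "x \<in> V \<Longrightarrow> 0 < (\<Sum>f\<in>incident E x. exp (- \<theta> f :: real))"
  using incident_nonempty finite_incident by (intro sum_pos) auto

lemma edge_curvature_log:
  assumes w: "positive_metric E w" and e: "e \<in> E"
  shows "edge_curvature V E w e = log_curvature (\<lambda>f. ln (w f)) e"
proof -
  have inv: "exp (- ln (w f)) = 1 / w f" if "f \<in> E" for f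
    using w that by (simp add: positive_metric_def exp_minus divide_inverse)
  have "inv_weight_sum E w x = (\<Sum>f\<in>incident E x. exp (- ln (w f)))" for x
    unfolding inv_weight_sum_def
    by (intro sum.cong refl) (simp add: inv[OF subsetD[OF incident_subset]])
  thus ?thesis
    unfolding edge_curvature_tree[OF w e] blend_def share_def using e
    by (intro sum.cong refl) (auto simp: incident_def inv)
qed

lemma share_in_shares: "share \<theta> \<in> shares"
proof -
  have "(\<Sum>e\<in>incident E x. share \<theta> x e) = 1" if "x \<in> V" for x
    using partition_pos[OF that, of \<theta>] by (simp add: share_def sum_divide_distrib[symmetric])
  moreover have "0 \<le> share \<theta> x e" for x e
    by (auto simp: share_def intro!: divide_nonneg_nonneg sum_nonneg)
  ultimately show ?thesis by (auto simp: shares_def share_def)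
qed

text \<open>Multiplying all weights by one factor leaves the jump distributions unchanged; this
  links the normalized flow to the unnormalized one.\<close>

lemma share_shift: "share (\<lambda>e. \<theta> e + k) = share \<theta>"
  by (intro ext) (simp add: share_def exp_add exp_diff exp_minus sum_divide_distrib[symmetric])

lemma sum_share_incident:
  assumes "q \<in> shares"
  shows "(\<Sum>e\<in>E. q x e * g e) = (\<Sum>e\<in>incident E x. q x e * g e)"
  using assms finite_E incident_subset by (intro sum.mono_neutral_right) (auto simp: shares_def)

lemma sum_blend: "(\<Sum>e\<in>A. blend q e * g e) = (\<Sum>x\<in>V. (2 - real (deg x)) * (\<Sum>e\<in>A. q x e * g e))"
  unfolding blend_def sum_distrib_left sum_distrib_right
  by (subst sum.swap) (simp add: mult.assoc)

lemma sum_share_full: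
  assumes "q \<in> shares" "x \<in> V" "A \<subseteq> E" "incident E x \<subseteq> A"
  shows "(\<Sum>e\<in>A. q x e) = 1"
proof -
  have "(\<Sum>e\<in>A. q x e) = (\<Sum>e\<in>incident E x. q x e)"
    using assms finite_E finite_subset
    by (intro sum.mono_neutral_right) (auto simp: shares_def)
  thus ?thesis using assms by (simp add: shares_def)
qed

lemma leaf_incident:
  assumes "deg x = 1" obtains f where "incident E x = {f}"
  using assms by (auto simp: gdegree_def card_1_singleton_iff)

lemma sum_share_leaf:
  assumes "q \<in> shares" "deg x = 1" "\<not> incident E x \<subseteq> A"
  shows "(\<Sum>e\<in>A. q x e) = 0"
proof (rule sum.neutral, rule ballI)
  fix e assume "e \<in> A"
  obtain f where "incident E x = {f}" by (rule leaf_incident[OF assms(2)])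
  hence "e \<notin> incident E x" using \<open>e \<in> A\<close> assms(3) by auto
  thus "q x e = 0" using assms(1) by (simp add: shares_def)
qed

section \<open>The set function \<open>beta\<close> and its base polytope\<close>

lemma beta_alt: "beta V E A = (\<Sum>x\<in>V. if incident E x \<subseteq> A then 2 - real (deg x) else 0)"
  unfolding beta_def by (rule sum.inter_filter[OF finite_V])

lemma beta_empty: "beta V E {} = 0"
  unfolding beta_alt using incident_nonempty by (intro sum.neutral) auto

text \<open>Only leaves carry a positive coefficient \<open>2 - deg\<close>, and their stars are
  single edges. The sign arguments for submodularity, for the base polytope and for convexity all
  split this way.\<close>

lemma deg_cases: assumes "x \<in> V" obtains "deg x = 1" | "2 - real (deg x) \<le> 0"
  using deg_pos[OF assms] by (cases "deg x = 1") auto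

text \<open>The inequality holds vertex by vertex: containment of a star is supermodular in the set,
  and modular if the star is a single edge, while the coefficients of all non-leaves are at most
  zero.\<close>

lemma submodular_beta: "submodular_on E (beta V E)"
  unfolding submodular_on_def
proof (intro allI impI)
  fix A B
  show "beta V E (A \<union> B) + beta V E (A \<inter> B) \<le> beta V E A + beta V E B"
    unfolding beta_alt sum.distrib[symmetric]
  proof (rule sum_mono)
    fix x assume "x \<in> V"
    thus "(if incident E x \<subseteq> A \<union> B then 2 - real (deg x) else 0) +
         (if incident E x \<subseteq> A \<inter> B then 2 - real (deg x) else 0)
         \<le> (if incident E x \<subseteq> A then 2 - real (deg x) else 0) +
            (if incident E x \<subseteq> B then 2 - real (deg x) else 0)"
    proof (cases rule: deg_cases)
      case 1
      then obtain f where "incident E x = {f}" by (rule leaf_incident)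
      thus ?thesis by auto
    next
      case 2
      have "incident E x \<subseteq> A \<Longrightarrow> incident E x \<subseteq> A \<union> B" "incident E x \<subseteq> B \<Longrightarrow> incident E x \<subseteq> A \<union> B"
        "incident E x \<subseteq> A \<inter> B \<longleftrightarrow> incident E x \<subseteq> A \<and> incident E x \<subseteq> B" by auto
      with 2 show ?thesis by (simp split: if_splits)
    qed
  qed
qed

text \<open>Vertex by vertex: a star inside \<open>A\<close> has its full mass 1 there, a leaf whose
  edge is outside has mass 0, and any other star has nonnegative mass and a coefficient at most
  zero.\<close>

lemma blend_in_base:
  assumes q: "q \<in> shares"
  shows "blend q \<in> base_polytope E (beta V E)"
  unfolding base_polytope_def
proof (intro CollectI conjI allI impI)
  have sum: "sum (blend q) A = (\<Sum>x\<in>V. (2 - real (deg x)) * (\<Sum>e\<in>A. q x e))" for A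
    using sum_blend[of q "\<lambda>_. 1" A] by simp
  show "sum (blend q) E = beta V E E"
    unfolding sum beta_alt using sum_share_full[OF q _ order_refl incident_subset] incident_subset
    by (intro sum.cong) auto
  fix A assume A: "A \<subseteq> E"
  show "sum (blend q) A \<le> beta V E A"
    unfolding sum beta_alt
  proof (rule sum_mono)
    fix x assume x: "x \<in> V"
    show "(2 - real (deg x)) * (\<Sum>e\<in>A. q x e) \<le> (if incident E x \<subseteq> A then 2 - real (deg x) else 0)"
    proof (cases "incident E x \<subseteq> A")
      case True
      thus ?thesis using sum_share_full[OF q x A] by simp
    next
      case False
      from x show ?thesis
      proof (cases rule: deg_cases)
        case 1
        thus ?thesis using sum_share_leaf[OF q 1 False] by simp
      next
        case 2
        have "0 \<le> (\<Sum>e\<in>A. q x e)" using q by (intro sum_nonneg) (simp add: shares_def)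
        thus ?thesis using 2 False by (simp add: mult_nonpos_nonneg)
      qed
    qed
  qed
qed

section \<open>Least-norm vertex distributions and their optimality conditions\<close>

lemma compact_shares: "compact shares"
proof -
  let ?K = "{q. \<forall>x. q x \<in> {g. \<forall>e. g e \<in> (if e \<in> incident E x then {0..1} else {0 :: real})}}"
  let ?C = "\<Inter>x\<in>V. {q. (\<Sum>e\<in>incident E x. q x e) = (1 :: real)}"
  have le1: "q x e \<le> 1" if "q \<in> shares" "e \<in> incident E x" for q x e
  proof -
    have "x \<in> V" using that(2) edge_subset by (auto simp: incident_def)
    thus ?thesis
      using member_le_sum[OF that(2), of "q x"] finite_incident[of x] that(1) by (simp add: shares_def)
  qed
  \<comment> \<open>\<open>?K\<close> is a product of intervals and points, compact by Tychonoff;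
    \<open>?C\<close> collects the normalizations, which are closed conditions.\<close>
  have "shares = ?K \<inter> ?C"
  proof (intro set_eqI iffI IntI)
    fix q assume q: "q \<in> shares"
    show "q \<in> ?K" using q le1[OF q] by (auto simp: shares_def)
    show "q \<in> ?C" using q by (auto simp: shares_def)
  next
    fix q assume q: "q \<in> ?K \<inter> ?C"
    have "q x e \<in> (if e \<in> incident E x then {0..1} else {0})" for x e using q by blast
    hence "0 \<le> q x e" "e \<notin> incident E x \<Longrightarrow> q x e = 0" for x e
      by (metis atLeastAtMost_iff order_refl singletonD)+
    thus "q \<in> shares" using q by (auto simp: shares_def)
  qed
  moreover have "compact ?K" by (intro compact_coordinatewise) auto
  moreover have "closed ?C"
    by (intro closed_INT ballI closed_Collect_eq continuous_intros continuous_on_coordinate2)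
  ultimately show ?thesis by (simp add: compact_Int_closed)
qed

text \<open>The minimum is taken over distributions rather than over their images under
  \<open>blend\<close>, so that mass at a single vertex can later be moved.\<close>

definition minimizing_share :: "('a \<Rightarrow> 'a set \<Rightarrow> real) \<Rightarrow> bool" where
  "minimizing_share q \<longleftrightarrow> q \<in> shares
     \<and> (\<forall>q'\<in>shares. (\<Sum>e\<in>E. (blend q e)\<^sup>2) \<le> (\<Sum>e\<in>E. (blend q' e)\<^sup>2))"

lemma minimizing_share_exists: "\<exists>q. minimizing_share q"
proof -
  have "continuous_on shares (\<lambda>q. \<Sum>e\<in>E. (blend q e)\<^sup>2)"
    unfolding blend_def
    by (intro continuous_intros continuous_on_coordinate2)
  from continuous_attains_inf[OF compact_shares _ this] share_in_shares
  show ?thesis by (auto simp: minimizing_share_def)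
qed

lemma shares_convex:
  assumes "q \<in> shares" "q' \<in> shares" "0 \<le> s" "s \<le> (1 :: real)"
  shows "(\<lambda>x e. (1 - s) * q x e + s * q' x e) \<in> shares"
  using assms by (auto simp: shares_def sum.distrib sum_distrib_left[symmetric])

lemma blend_convex:
  "blend (\<lambda>x e. (1 - s) * q x e + s * q' x e) e = blend q e + s * (blend q' e - blend q e)"
  unfolding blend_def
  unfolding sum_subtractf[symmetric] sum_distrib_left sum.distrib[symmetric]
  by (intro sum.cong refl) (simp add: algebra_simps)

lemma blend_segment_norm:
  "(\<Sum>e\<in>E. (blend q e + s * (blend q' e - blend q e))\<^sup>2) = (\<Sum>e\<in>E. (blend q e)\<^sup>2)
    + s * (2 * (\<Sum>e\<in>E. blend q e * (blend q' e - blend q e)) + s * (\<Sum>e\<in>E. (blend q' e - blend q e)\<^sup>2))"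
proof -
  have "(blend q e + s * (blend q' e - blend q e))\<^sup>2 = (blend q e)\<^sup>2
    + s * (2 * (blend q e * (blend q' e - blend q e)) + s * (blend q' e - blend q e)\<^sup>2)" for e
    by (simp add: power2_eq_square algebra_simps)
  thus ?thesis by (simp only: sum.distrib sum_distrib_left[symmetric])
qed

text \<open>Along the segment from \<open>q\<close> to \<open>q'\<close> the squared norm is
  quadratic in \<open>s\<close> and least at \<open>s = 0\<close>. Dividing the increment by
  \<open>s\<close> and letting \<open>s\<close> tend to 0 isolates the linear coefficient.\<close>

lemma variational_inequality:
  assumes q: "minimizing_share q" and q': "q' \<in> shares"
  shows "0 \<le> (\<Sum>e\<in>E. blend q e * (blend q' e - blend q e))"
proof -
  define a where "a = (\<Sum>e\<in>E. blend q e * (blend q' e - blend q e))"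
  define b where "b = (\<Sum>e\<in>E. (blend q' e - blend q e)\<^sup>2)"
  have nonneg: "0 \<le> 2 * a + s * b" if s: "0 < s" "s \<le> 1" for s
  proof -
    have "(\<Sum>e\<in>E. (blend q e)\<^sup>2) \<le> (\<Sum>e\<in>E. (blend (\<lambda>x e. (1 - s) * q x e + s * q' x e) e)\<^sup>2)"
      using shares_convex[of q q' s] q q' s by (auto simp: minimizing_share_def)
    hence "0 \<le> s * (2 * a + s * b)"
      unfolding blend_convex blend_segment_norm by (simp add: a_def b_def)
    thus ?thesis using s by (simp add: zero_le_mult_iff)
  qed
  have "((\<lambda>s. 2 * a + s * b) \<longlongrightarrow> 2 * a + 0 * b) (at_right 0)" by (intro tendsto_intros)
  moreover have "\<forall>\<^sub>F s in at_right 0. 0 \<le> 2 * a + s * b"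
    unfolding eventually_at_right_field using nonneg by (intro exI[of _ 1]) auto
  ultimately have "0 \<le> 2 * a + 0 * b" by (rule tendsto_lowerbound) simp
  thus ?thesis by (simp add: a_def)
qed

text \<open>Moving the mass of \<open>q x\<close> from \<open>e\<close> to \<open>f\<close> must not decrease the norm to first order.\<close>

lemma minimizing_share_support:
  assumes q: "minimizing_share q" and x: "x \<in> V" "2 < deg x"
    and ef: "e \<in> incident E x" "f \<in> incident E x" and pos: "q x e \<noteq> 0"
  shows "blend q f \<le> blend q e"
proof (cases "e = f")
  case False
  have qs: "q \<in> shares" using q by (simp add: minimizing_share_def)
  define \<delta> where "\<delta> = q x e"
  have \<delta>: "0 < \<delta>" using qs pos by (simp add: shares_def \<delta>_def less_le)
  define m where "m g = (if g = f then \<delta> else 0) - (if g = e then \<delta> else 0)" for g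
  define q' where "q' y g = q y g + (if y = x then m g else 0)" for y g
  have "(\<Sum>g\<in>incident E x. m g) = 0"
    using ef finite_incident[of x] by (simp add: m_def sum_subtractf)
  hence sums: "(\<Sum>g\<in>incident E y. q' y g) = (\<Sum>g\<in>incident E y. q y g)" for y
    by (cases "y = x") (simp_all add: q'_def sum.distrib)
  have "0 \<le> q' y g" for y g
    using qs \<delta> False by (auto simp: q'_def m_def \<delta>_def shares_def)
  moreover have "q' y g = 0" if "g \<notin> incident E y" for y g
    using qs that ef by (auto simp: q'_def m_def shares_def)
  ultimately have q's: "q' \<in> shares" using qs sums by (simp add: shares_def)
  have diff: "blend q' g - blend q g = (2 - real (deg x)) * m g" for g
  proof -
    have "blend q' g - blend q g = (\<Sum>y\<in>V. if y = x then (2 - real (deg x)) * m g else 0)"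
      unfolding blend_def sum_subtractf[symmetric]
      by (intro sum.cong refl) (simp add: q'_def algebra_simps)
    thus ?thesis using x finite_V by simp
  qed
  have "0 \<le> (\<Sum>g\<in>E. blend q g * ((2 - real (deg x)) * m g))"
    using variational_inequality[OF q q's] by (simp add: diff)
  also have "\<dots> = (2 - real (deg x)) * (\<Sum>g\<in>E. blend q g * m g)"
    by (simp add: sum_distrib_left mult_ac)
  also have "(\<Sum>g\<in>E. blend q g * m g)
      = (\<Sum>g\<in>E. if g = f then blend q f * \<delta> else 0) - (\<Sum>g\<in>E. if g = e then blend q e * \<delta> else 0)"
    unfolding sum_subtractf[symmetric] by (intro sum.cong refl) (simp add: m_def)
  also have "\<dots> = (blend q f - blend q e) * \<delta>"
    using ef incident_subset[of x] finite_E by (auto simp: algebra_simps)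
  finally show ?thesis using x(2) \<delta> by (auto simp: zero_le_mult_iff mult_le_0_iff)
qed simp

text \<open>For a sublevel set \<open>A\<close> each vertex contributes equally to
  \<open>beta\<close> and to the sum of \<open>blend q\<close>. The delicate case is a degree above
  2 with an incident edge \<open>f\<close> outside \<open>A\<close>: edges in \<open>A\<close> have
  a smaller value than \<open>f\<close>, so \<open>minimizing_share_support\<close> forbids mass on
  them.\<close>

lemma tight_minimizing_share:
  assumes q: "minimizing_share q"
  shows "tight_base E (beta V E) (blend q)"
proof
  have qs: "q \<in> shares" using q by (simp add: minimizing_share_def)
  show "blend q \<in> base_polytope E (beta V E)" by (rule blend_in_base[OF qs])
  fix t
  define A where "A = {e \<in> E. blend q e \<le> t}"
  have A: "A \<subseteq> E" by (auto simp: A_def)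
  have "(if incident E x \<subseteq> A then 2 - real (deg x) else 0) = (2 - real (deg x)) * (\<Sum>e\<in>A. q x e)"
    if x: "x \<in> V" for x
  proof (cases "incident E x \<subseteq> A")
    case True
    thus ?thesis using sum_share_full[OF qs x A] by simp
  next
    case False
    consider "deg x = 1" | "deg x = 2" | "2 < deg x" using deg_pos[OF x] by linarith
    thus ?thesis
    proof cases
      case 1
      thus ?thesis using sum_share_leaf[OF qs 1 False] False by simp
    next
      case 3
      obtain f where f: "f \<in> incident E x" "f \<notin> A" using False by blast
      have "q x e = 0" if e: "e \<in> A" for e
      proof (cases "e \<in> incident E x")
        case True
        have "blend q e \<le> t" "t < blend q f" using e f incident_subset by (auto simp: A_def)
        thus ?thesis using minimizing_share_support[OF q x 3 True f(1)] by fastforce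
      qed (use qs in \<open>simp add: shares_def\<close>)
      thus ?thesis using False by simp
    qed simp
  qed
  hence "beta V E A = (\<Sum>x\<in>V. (2 - real (deg x)) * (\<Sum>e\<in>A. q x e))"
    unfolding beta_alt by (intro sum.cong) auto
  also have "\<dots> = sum (blend q) A" using sum_blend[of q "\<lambda>_. 1" A] by simp
  finally show "beta V E {e \<in> E. blend q e \<le> t} = (\<Sum>e | e \<in> E \<and> blend q e \<le> t. blend q e)"
    by (simp add: A_def)
qed (use finite_E beta_empty in auto)

section \<open>Approximating the minimizer by metrics\<close>

text \<open>On a tree the vertex distributions can be prescribed independently: the scales
  \<open>exp (\<phi> x)\<close> that make them agree on every edge solve a potential equation.\<close>

lemma share_realizable:
  assumes q: "q \<in> shares" and pos: "\<And>x e. e \<in> incident E x \<Longrightarrow> 0 < q x e"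
  shows "\<exists>\<theta>. share \<theta> = q"
proof -
  have "ln (q v {u, v}) - ln (q u {u, v}) = - (ln (q u {v, u}) - ln (q v {v, u}))" for u v
    by (simp add: insert_commute[of v u])
  from tree_potential[of "\<lambda>u v. ln (q v {u, v}) - ln (q u {u, v})", OF this]
  obtain \<phi> where \<phi>: "\<And>u v. {u, v} \<in> E \<Longrightarrow> \<phi> u - \<phi> v = ln (q v {u, v}) - ln (q u {u, v})" by blast
  \<comment> \<open>Either end point may be chosen: by the equation for \<open>\<phi>\<close>, the
    quantity \<open>\<phi> x + ln (q x e)\<close> is the same at both ends of
    \<open>e\<close>.\<close>
  define tip where "tip e = (SOME x. x \<in> e)" for e :: "'a set"
  define \<theta> where "\<theta> e = - (\<phi> (tip e) + ln (q (tip e) e))" for e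
  have \<theta>: "exp (- \<theta> e) = exp (\<phi> x) * q x e" if e: "e \<in> incident E x" for e x
  proof -
    have eE: "e \<in> E" "x \<in> e" using e by (auto simp: incident_def)
    have tip: "tip e \<in> e" unfolding tip_def using eE(2) by (rule someI)
    have "\<phi> (tip e) + ln (q (tip e) e) = \<phi> x + ln (q x e)"
    proof (cases "tip e = x")
      case False
      hence "e = {tip e, x}" using tip eE edge_card[OF eE(1)] by (auto simp: card_2_iff)
      thus ?thesis using \<phi>[of "tip e" x] eE(1) by simp
    qed simp
    thus ?thesis using pos[OF e] by (simp add: \<theta>_def exp_add)
  qed
  have "share \<theta> x e = q x e" for x e
  proof (cases "e \<in> incident E x")
    case True
    hence x: "x \<in> V" using edge_subset by (auto simp: incident_def)
    have "(\<Sum>f\<in>incident E x. exp (- \<theta> f)) = exp (\<phi> x) * (\<Sum>f\<in>incident E x. q x f)"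
      unfolding sum_distrib_left by (intro sum.cong refl \<theta>)
    hence "(\<Sum>f\<in>incident E x. exp (- \<theta> f)) = exp (\<phi> x)" using q x by (simp add: shares_def)
    thus ?thesis using True \<theta>[OF True] by (simp add: share_def)
  qed (use q in \<open>simp add: share_def shares_def\<close>)
  thus ?thesis by blast
qed

text \<open>A minimizer may put zero mass on an incident edge, which no metric realizes. Mixing in a
  little of the uniform distributions makes these masses positive and changes the norm arbitrarily
  little.\<close>

lemma minimizing_share_approx:
  assumes q: "minimizing_share q" and \<epsilon>: "0 < \<epsilon>"
  shows "\<exists>\<theta>. (\<Sum>e\<in>E. (log_curvature \<theta> e)\<^sup>2) \<le> (\<Sum>e\<in>E. (blend q e)\<^sup>2) + \<epsilon>"
proof -
  have qs: "q \<in> shares" using q by (simp add: minimizing_share_def)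
  define u where "u = share (\<lambda>_. 0)"
  have us: "u \<in> shares" unfolding u_def by (rule share_in_shares)
  have u_pos: "0 < u x e" if "e \<in> incident E x" for x e
    using that partition_pos[of x "\<lambda>_. 0"] edge_subset by (auto simp: u_def share_def incident_def)
  define N where "N s = (\<Sum>e\<in>E. (blend q e + s * (blend u e - blend q e))\<^sup>2)" for s :: real
  have "(N \<longlongrightarrow> (\<Sum>e\<in>E. (blend q e + 0 * (blend u e - blend q e))\<^sup>2)) (at_right 0)"
    unfolding N_def by (intro tendsto_intros)
  hence "\<forall>\<^sub>F s in at_right 0. N s < (\<Sum>e\<in>E. (blend q e)\<^sup>2) + \<epsilon>"
    using \<epsilon> by (intro order_tendstoD(2)) auto
  moreover have "\<forall>\<^sub>F s in at_right (0 :: real). s \<in> {0<..<1}" by (rule eventually_at_right_real) simp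
  ultimately have "\<forall>\<^sub>F s in at_right 0. N s < (\<Sum>e\<in>E. (blend q e)\<^sup>2) + \<epsilon> \<and> s \<in> {0<..<1}"
    by (rule eventually_conj)
  then obtain s where s: "N s < (\<Sum>e\<in>E. (blend q e)\<^sup>2) + \<epsilon>" "0 < s" "s < 1"
    using eventually_happens'[of "at_right (0 :: real)"] by fastforce
  define qs' where "qs' = (\<lambda>x e. (1 - s) * q x e + s * u x e)"
  have "qs' \<in> shares" unfolding qs'_def using qs us s by (intro shares_convex) auto
  moreover have "0 < qs' x e" if "e \<in> incident E x" for x e
    unfolding qs'_def using u_pos[OF that] s qs
    by (intro add_nonneg_pos) (auto simp: shares_def)
  ultimately obtain \<theta> where "share \<theta> = qs'" using share_realizable by blast
  hence "(\<Sum>e\<in>E. (log_curvature \<theta> e)\<^sup>2) = N s"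
    by (simp add: N_def qs'_def blend_convex)
  thus ?thesis using s(1) by (intro exI[of _ \<theta>]) simp
qed

section \<open>The curvature flow as a convex gradient flow\<close>

lemma potential_convex:
  "(\<Sum>e\<in>E. log_curvature x e * (y e - x e)) \<le> potential y - potential x"
  unfolding sum_blend potential_def sum_subtractf[symmetric]
proof (rule sum_mono)
  fix v assume v: "v \<in> V"
  let ?S = "\<lambda>z. ln (\<Sum>f\<in>incident E v. exp (- z f))"
  have sum: "(\<Sum>e\<in>E. share x v e * (y e - x e)) = - (\<Sum>e\<in>incident E v.
      exp (- x e) / (\<Sum>f\<in>incident E v. exp (- x f)) * (x e - y e))"
    unfolding sum_share_incident[OF share_in_shares] sum_negf[symmetric]
    by (intro sum.cong refl) (simp add: share_def algebra_simps diff_divide_distrib)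
  show "(2 - real (deg v)) * (\<Sum>e\<in>E. share x v e * (y e - x e))
      \<le> (real (deg v) - 2) * ?S y - (real (deg v) - 2) * ?S x"
    using v
  proof (cases rule: deg_cases)
    case 1
    then obtain f where "incident E v = {f}" by (rule leaf_incident)
    thus ?thesis using 1 by (simp add: sum)
  next
    case 2
    have "(real (deg v) - 2) * (\<Sum>e\<in>incident E v.
        exp (- x e) / (\<Sum>f\<in>incident E v. exp (- x f)) * (x e - y e)) \<le> (real (deg v) - 2) * (?S y - ?S x)"
      using 2 incident_nonempty[OF v] finite_incident
      by (intro mult_left_mono ln_sum_exp_gradient_le) auto
    thus ?thesis unfolding sum by (simp add: algebra_simps)
  qed
qed

lemma log_flow_converges:
  assumes q: "minimizing_share q"
    and flow: "\<And>t e. 0 \<le> t \<Longrightarrow> e \<in> E \<Longrightarrow>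
      ((\<lambda>s. \<theta> s e) has_real_derivative - log_curvature (\<theta> t) e) (at t within {0..})"
    and e: "e \<in> E"
  shows "((\<lambda>t. log_curvature (\<theta> t) e) \<longlongrightarrow> blend q e) at_top"
proof -
  interpret convex_gradient_flow E potential log_curvature \<theta>
  proof
    fix t :: real assume t: "0 \<le> t"
    \<comment> \<open>The chain rule is applied at each vertex; \<open>sum_blend\<close> then
      regroups the vertex sums into minus the squared norm of the curvature.\<close>
    have "((\<lambda>s. potential (\<theta> s)) has_real_derivative
        (\<Sum>x\<in>V. (real (deg x) - 2) * (1 / (\<Sum>f\<in>incident E x. exp (- \<theta> t f))
          * (\<Sum>f\<in>incident E x. exp (- \<theta> t f) * log_curvature (\<theta> t) f)))) (at t within {0..})"
      unfolding potential_def
    proof (intro DERIV_sum DERIV_cmult)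
      fix x assume x: "x \<in> V"
      have "((\<lambda>s. \<Sum>f\<in>incident E x. exp (- \<theta> s f)) has_real_derivative
          (\<Sum>f\<in>incident E x. exp (- \<theta> t f) * log_curvature (\<theta> t) f)) (at t within {0..})"
      proof (rule DERIV_sum)
        fix f assume "f \<in> incident E x"
        hence "f \<in> E" using incident_subset by blast
        from DERIV_chain2[OF DERIV_exp DERIV_minus[OF flow[OF t this]]]
        show "((\<lambda>s. exp (- \<theta> s f)) has_real_derivative exp (- \<theta> t f) * log_curvature (\<theta> t) f)
            (at t within {0..})" by simp
      qed
      from DERIV_chain2[OF DERIV_ln_divide[OF partition_pos[OF x]] this]
      show "((\<lambda>s. ln (\<Sum>f\<in>incident E x. exp (- \<theta> s f))) has_real_derivative
          1 / (\<Sum>f\<in>incident E x. exp (- \<theta> t f))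
          * (\<Sum>f\<in>incident E x. exp (- \<theta> t f) * log_curvature (\<theta> t) f)) (at t within {0..})" .
    qed
    also have "(\<Sum>x\<in>V. (real (deg x) - 2) * (1 / (\<Sum>f\<in>incident E x. exp (- \<theta> t f))
          * (\<Sum>f\<in>incident E x. exp (- \<theta> t f) * log_curvature (\<theta> t) f)))
        = - (\<Sum>x\<in>V. (2 - real (deg x)) * (\<Sum>f\<in>E. share (\<theta> t) x f * log_curvature (\<theta> t) f))"
      unfolding sum_share_incident[OF share_in_shares] sum_negf[symmetric]
      by (intro sum.cong refl)
        (simp add: share_def sum_divide_distrib[symmetric] algebra_simps diff_divide_distrib)
    also have "\<dots> = - (\<Sum>e\<in>E. (log_curvature (\<theta> t) e)\<^sup>2)"
      unfolding sum_blend[symmetric] by (simp add: power2_eq_square)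
    finally show "((\<lambda>s. potential (\<theta> s)) has_real_derivative
        - (\<Sum>e\<in>E. (log_curvature (\<theta> t) e)\<^sup>2)) (at t within {0..})" .
  qed (use finite_E flow potential_convex in auto)
  show ?thesis
  proof (rule gradient_converges[OF _ _ e])
    fix x
    have "0 \<le> (\<Sum>e\<in>E. blend q e * (log_curvature x e - blend q e))"
      by (rule variational_inequality[OF q share_in_shares])
    thus "(\<Sum>e\<in>E. (blend q e)\<^sup>2) \<le> (\<Sum>e\<in>E. blend q e * log_curvature x e)"
      by (simp add: right_diff_distrib sum_subtractf power2_eq_square)
  qed (rule minimizing_share_approx[OF q])
qed

lemma log_weight_deriv:
  assumes "positive_metric E (w t)" "e \<in> E"
    and "((\<lambda>s. w s e) has_real_derivative w t e * D) (at t within {0..})"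
  shows "((\<lambda>s. ln (w s e)) has_real_derivative D) (at t within {0..})"
proof -
  have pos: "0 < w t e" using assms by (simp add: positive_metric_def)
  from DERIV_chain2[OF DERIV_ln_divide[OF this] assms(3)] show ?thesis using pos by simp
qed

text \<open>
  A normalized solution is an unnormalized one up to the factor \<open>exp (\<integral>K)\<close>, and the curvature
  is invariant under scaling.
\<close>

lemma ricci_flow_log:
  assumes "ricci_flow V E w"
  shows "\<exists>I. \<forall>t\<ge>0. positive_metric E (w t) \<and> (\<forall>e\<in>E. ((\<lambda>s. ln (w s e) + I s)
    has_real_derivative - log_curvature (\<lambda>f. ln (w t f) + I t) e) (at t within {0..}))"
  using assms unfolding ricci_flow_def
proof
  assume u: "unnormalized_ricci_flow V E w"
  have "((\<lambda>s. ln (w s e)) has_real_derivative - log_curvature (\<lambda>f. ln (w t f)) e) (at t within {0..})"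
    if te: "0 \<le> t" "e \<in> E" for t e
  proof (rule log_weight_deriv[where w = w, OF _ te(2)])
    show pos: "positive_metric E (w t)" using u te by (simp add: unnormalized_ricci_flow_def)
    have "((\<lambda>s. w s e) has_real_derivative - edge_curvature V E (w t) e * w t e) (at t within {0..})"
      using u te by (simp add: unnormalized_ricci_flow_def)
    thus "((\<lambda>s. w s e) has_real_derivative w t e * - log_curvature (\<lambda>f. ln (w t f)) e)
        (at t within {0..})"
      by (simp add: edge_curvature_log[OF pos te(2)] mult.commute)
  qed
  thus ?thesis using u by (intro exI[of _ "\<lambda>_. 0"]) (simp add: unnormalized_ricci_flow_def)
next
  assume n: "normalized_ricci_flow V E w"
  have pos: "positive_metric E (w t)" if "0 \<le> t" for t
    using n that by (simp add: normalized_ricci_flow_def)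
  define K where "K t = (\<Sum>f\<in>E. w t f * log_curvature (\<lambda>f. ln (w t f)) f)" for t
  have K: "mean_curvature V E (w t) = K t" if "0 \<le> t" for t
    unfolding mean_curvature_def K_def using edge_curvature_log[OF pos[OF that]] by simp
  have ln_deriv: "((\<lambda>s. ln (w s e)) has_real_derivative
      K t - log_curvature (\<lambda>f. ln (w t f)) e) (at t within {0..})" if te: "0 \<le> t" "e \<in> E" for t e
  proof (rule log_weight_deriv[where w = w, OF pos[OF te(1)] te(2)])
    have "((\<lambda>s. w s e) has_real_derivative
        - (w t e * (edge_curvature V E (w t) e - mean_curvature V E (w t)))) (at t within {0..})"
      using n te by (simp add: normalized_ricci_flow_def)
    thus "((\<lambda>s. w s e) has_real_derivative w t e * (K t - log_curvature (\<lambda>f. ln (w t f)) e))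
        (at t within {0..})"
      unfolding edge_curvature_log[OF pos[OF te(1)] te(2)] K[OF te(1)]
      by (simp add: mult_minus_right[symmetric] del: mult_minus_right)
  qed
  have cont_ln: "continuous_on {0..} (\<lambda>s. ln (w s e))" if "e \<in> E" for e
    using DERIV_continuous[OF ln_deriv[OF _ that]] by (simp add: continuous_on_eq_continuous_within)
  have cont_w: "continuous_on {0..} (\<lambda>s. w s e)" if "e \<in> E" for e
    using n that DERIV_continuous
    by (fastforce simp: continuous_on_eq_continuous_within normalized_ricci_flow_def)
  have cont_share: "continuous_on {0..} (\<lambda>s. share (\<lambda>f. ln (w s f)) x e)" if x: "x \<in> V" for x e
  proof (cases "e \<in> incident E x")
    case True
    have "continuous_on {0..} (\<lambda>s. exp (- ln (w s f)))" if "f \<in> incident E x" for f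
      using cont_ln[of f] that incident_subset by (intro continuous_on_exp continuous_on_minus) auto
    thus ?thesis using True partition_pos[OF x] unfolding share_def
      by (simp, intro continuous_on_divide continuous_on_sum) (auto simp: less_imp_neq[symmetric])
  qed (simp add: share_def)
  \<comment> \<open>Continuity is what makes the integral of \<open>K\<close> an
    antiderivative.\<close>
  have contK: "continuous_on {0..} K"
    unfolding K_def blend_def by (intro continuous_intros cont_w cont_share) auto
  define I where "I t = integral {0..t} K" for t
  have I: "(I has_real_derivative K t) (at t within {0..})" if t: "0 \<le> t" for t
  proof -
    \<comment> \<open>The upper limit \<open>t + 1\<close> leaves room to the right of
      \<open>t\<close>, so near \<open>t\<close> the compact interval and the half-line
      agree.\<close>
    have "(I has_real_derivative K t) (at t within {0..t + 1})"
      unfolding I_def using t continuous_on_subset[OF contK]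
      by (intro integral_has_real_derivative) auto
    moreover have "at t within {0..t + 1} = at t within {0..}"
      by (rule at_within_nhd[of _ "{..<t + 1}"]) auto
    ultimately show ?thesis by simp
  qed
  show ?thesis
  proof (intro exI[of _ "\<lambda>s. - I s"] allI impI conjI ballI)
    fix t :: real and e assume te: "0 \<le> t" "e \<in> E"
    show "((\<lambda>s. ln (w s e) + - I s) has_real_derivative
        - log_curvature (\<lambda>f. ln (w t f) + - I t) e) (at t within {0..})"
      using DERIV_add[OF ln_deriv[OF te] DERIV_minus[OF I[OF te(1)]]] unfolding share_shift by simp
  qed (rule pos)
qed

text \<open>The choice of \<open>q\<close> does not involve the flow, so all flows on the tree share
  the limit \<open>blend q\<close>.\<close>

lemma curvature_converges:
  assumes q: "minimizing_share q" and w: "ricci_flow V E w" and e: "e \<in> E"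
  shows "((\<lambda>t. edge_curvature V E (w t) e) \<longlongrightarrow> blend q e) at_top"
proof -
  from ricci_flow_log[OF w] obtain I where
    *: "\<forall>t\<ge>0. positive_metric E (w t) \<and> (\<forall>e\<in>E. ((\<lambda>s. ln (w s e) + I s)
      has_real_derivative - log_curvature (\<lambda>f. ln (w t f) + I t) e) (at t within {0..}))"
    by (rule exE)
  have I: "positive_metric E (w t)" "e \<in> E \<Longrightarrow> ((\<lambda>s. ln (w s e) + I s)
      has_real_derivative - log_curvature (\<lambda>f. ln (w t f) + I t) e) (at t within {0..})"
    if "0 \<le> t" for t e
    using *[rule_format, OF that] by simp_all
  have "((\<lambda>t. log_curvature (\<lambda>f. ln (w t f) + I t) e) \<longlongrightarrow> blend q e) at_top"
    by (rule log_flow_converges[where \<theta> = "\<lambda>t f. ln (w t f) + I t", OF q I(2) e])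
  moreover have "\<forall>\<^sub>F t in at_top. log_curvature (\<lambda>f. ln (w t f) + I t) e = edge_curvature V E (w t) e"
    using eventually_ge_at_top[of 0] by eventually_elim (simp add: share_shift edge_curvature_log I(1) e)
  ultimately show ?thesis by (rule Lim_transform_eventually)
qed

end

section \<open>Limiting curvature and the set function\<close>

text \<open>The first conjunct certifies that the values given by \<open>Lim\<close> are genuine
  limits. That the recursion determines \<open>c\<close> from the tree alone is expressed by two
  conjuncts: any run of it from \<open>{}\<close> to \<open>E\<close> reads off the values of
  \<open>c\<close>, and every other flow has the same limits.\<close>

theorem theorem1p3:
  fixes V :: "'a set" and E :: "'a set set"
    and w :: "real \<Rightarrow> 'a set \<Rightarrow> real"
    and c :: "'a set \<Rightarrow> real" and c_min :: real and E_min :: "'a set set"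
    and r :: nat and \<alpha> :: "nat \<Rightarrow> real" and A :: "nat \<Rightarrow> 'a set set"
  assumes tree: "finite_tree V E" and edge: "E \<noteq> {}"
    and flow: "ricci_flow V E w"
    and c: "\<And>e. e \<in> E \<Longrightarrow> c e = limit_curvature V E w e"
    and c_min: "c_min = Min (c ` E)"
    and E_min: "E_min = {e \<in> E. c e = c_min}"
    and \<alpha>_mono: "strict_mono_on {1..r} \<alpha>"
    and \<alpha>_values: "\<alpha> ` {1..r} = c ` E"
    and A_0: "A 0 = {}"
    and A_j: "\<And>j. 1 \<le> j \<Longrightarrow> j \<le> r \<Longrightarrow> A j = {e \<in> E. c e \<le> \<alpha> j}"
  shows
    "(\<forall>e\<in>E. ((\<lambda>t. edge_curvature V E (w t) e) \<longlongrightarrow> c e) at_top)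
   \<and> submodular_on E (beta V E)
   \<and> (\<forall>z. is_arg_min (\<lambda>z. 1 / 2 * (\<Sum>e\<in>E. (z e)\<^sup>2)) (\<lambda>z. z \<in> base_polytope E (beta V E)) z
          \<longleftrightarrow> (\<forall>e\<in>E. z e = c e))
   \<and> A r = E
   \<and> (\<forall>j\<le>r. beta V E (A j) = (\<Sum>e\<in>A j. c e))
   \<and> (\<forall>j<r. \<alpha> (Suc j) = (MIN B\<in>{B. A j \<subset> B \<and> B \<subseteq> E}. slope (beta V E) (A j) B)
          \<and> unique_largest_minimizer (slope (beta V E) (A j)) {B. A j \<subset> B \<and> B \<subseteq> E} (A (Suc j)))
   \<and> (\<forall>r' \<alpha>' A'. A' 0 = {} \<and> A' r' = E
          \<and> (\<forall>j<r'. \<alpha>' (Suc j) = (MIN B\<in>{B. A' j \<subset> B \<and> B \<subseteq> E}. slope (beta V E) (A' j) B)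
               \<and> unique_largest_minimizer (slope (beta V E) (A' j)) {B. A' j \<subset> B \<and> B \<subseteq> E} (A' (Suc j)))
          \<longrightarrow> (\<forall>j<r'. \<forall>e\<in>A' (Suc j) - A' j. c e = \<alpha>' (Suc j)))
   \<and> (\<forall>w'. ricci_flow V E w' \<longrightarrow>
          (\<forall>e\<in>E. ((\<lambda>t. edge_curvature V E (w' t) e) \<longlongrightarrow> c e) at_top))
   \<and> c_min = (MIN B\<in>{B. B \<noteq> {} \<and> B \<subseteq> E}. avg_density (beta V E) B)
   \<and> unique_largest_minimizer (avg_density (beta V E)) {B. B \<noteq> {} \<and> B \<subseteq> E} E_min
   \<and> E_min = \<Union>{B. B \<subseteq> E \<and> B \<noteq> {} \<and> beta V E B = c_min * real (card B)}
   \<and> beta V E E_min = c_min * real (card E_min)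
   \<and> (\<forall>B C. is_arg_min (avg_density (beta V E)) (\<lambda>B. B \<noteq> {} \<and> B \<subseteq> E) B
          \<and> is_arg_min (avg_density (beta V E)) (\<lambda>B. B \<noteq> {} \<and> B \<subseteq> E) C
        \<longrightarrow> is_arg_min (avg_density (beta V E)) (\<lambda>B. B \<noteq> {} \<and> B \<subseteq> E) (B \<union> C)
          \<and> (B \<inter> C \<noteq> {} \<longrightarrow> is_arg_min (avg_density (beta V E)) (\<lambda>B. B \<noteq> {} \<and> B \<subseteq> E) (B \<inter> C)))"
proof -
  interpret nontrivial_tree V E using tree edge by unfold_locales
  let ?f = "beta V E"
  obtain q where q: "minimizing_share q" using minimizing_share_exists by blast
  have conv: "((\<lambda>t. edge_curvature V E (w' t) e) \<longlongrightarrow> blend q e) at_top"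
    if "ricci_flow V E w'" "e \<in> E" for w' e
    by (rule curvature_converges[OF q that])
  have cq: "c e = blend q e" if "e \<in> E" for e
    using tendsto_Lim[OF _ conv[OF flow that]] c[OF that] by (simp add: limit_curvature_def)
  interpret tight_base E ?f c
    by (rule tight_base_cong[OF tight_minimizing_share[OF q]]) (simp add: cq)

  \<comment> \<open>The chain of level sets and its recursion\<close>
  have r_pos: "1 \<le> r" using \<alpha>_values edge by (cases r) auto
  have \<alpha>_le: "\<alpha> i \<le> \<alpha> j" if "1 \<le> i" "i \<le> j" "j \<le> r" for i j
    using strict_mono_on_leD[OF \<alpha>_mono, of i j] that by simp
  have \<alpha>_less: "\<alpha> i < \<alpha> j" if "1 \<le> i" "i < j" "j \<le> r" for i j
    using strict_mono_onD[OF \<alpha>_mono, of i j] that by simp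
  have index: "\<exists>i\<in>{1..r}. c e = \<alpha> i" if "e \<in> E" for e
  proof -
    have "c e \<in> \<alpha> ` {1..r}" unfolding \<alpha>_values using that by (rule imageI)
    thus ?thesis by auto
  qed
  have A_r: "A r = E"
    using A_j[of r] r_pos index \<alpha>_le by fastforce
  \<comment> \<open>Index 0 is treated apart, since \<open>A 0\<close> is given as the empty set and
    not as a level set.\<close>
  have tight_A: "A j \<subseteq> E \<and> ?f (A j) = (\<Sum>e\<in>A j. c e)" if "j \<le> r" for j
    using A_0 A_j[of j] that tight[of "\<alpha> j"] f_empty by (cases "j = 0") auto
  have step: "\<alpha> (Suc j) = (MIN B\<in>{B. A j \<subset> B \<and> B \<subseteq> E}. slope ?f (A j) B)"
    "unique_largest_minimizer (slope ?f (A j)) {B. A j \<subset> B \<and> B \<subseteq> E} (A (Suc j))"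
    if j: "j < r" for j
  proof -
    have above: "\<alpha> (Suc j) \<le> c e" if e: "e \<in> E - A j" for e
    proof -
      obtain i where i: "i \<in> {1..r}" "c e = \<alpha> i" using index e by blast
      have "j < i"
      proof (rule ccontr)
        assume "\<not> j < i"
        hence "e \<in> A j" using A_j[of j] \<alpha>_le[of i j] i e j by auto
        thus False using e by simp
      qed
      thus ?thesis using \<alpha>_le[of "Suc j" i] i by auto
    qed
    have "\<alpha> (Suc j) \<in> c ` E" unfolding \<alpha>_values[symmetric] using j by (intro imageI) simp
    then obtain e where e: "e \<in> E" "c e = \<alpha> (Suc j)" by auto
    have "e \<notin> A j"
      using A_0 A_j[of j] e \<alpha>_less[of j "Suc j"] j by (cases "j = 0") auto
    hence a: "\<alpha> (Suc j) \<in> c ` (E - A j)" using e by (auto intro!: image_eqI[of _ c e])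
    have L: "A (Suc j) = {e \<in> E. c e \<le> \<alpha> (Suc j)}" using A_j[of "Suc j"] j by simp
    have "A j \<subseteq> A (Suc j)"
      using A_0 A_j[of j] \<alpha>_le[of j "Suc j"] j unfolding L by (cases "j = 0") auto
    note * = slope_level[OF _ _ above a L this]
    show "\<alpha> (Suc j) = (MIN B\<in>{B. A j \<subset> B \<and> B \<subseteq> E}. slope ?f (A j) B)"
      "unique_largest_minimizer (slope ?f (A j)) {B. A j \<subset> B \<and> B \<subseteq> E} (A (Suc j))"
      using * tight_A[of j] j by auto
  qed
  have level_value: "c e = \<alpha> (Suc j)" if j: "j < r" and e: "e \<in> A (Suc j) - A j" for j e
  proof -
    have eE: "e \<in> E" "c e \<le> \<alpha> (Suc j)" using e A_j[of "Suc j"] j by auto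
    then obtain i where i: "i \<in> {1..r}" "c e = \<alpha> i" using index by blast
    have "\<not> i \<le> j"
      using e eE A_j[of j] \<alpha>_le[of i j] i j by auto
    moreover have "\<not> Suc j < i" using \<alpha>_less[of "Suc j" i] i eE by auto
    ultimately have "i = Suc j" by linarith
    thus ?thesis using i by simp
  qed
  have recursion: "c e = \<alpha>' (Suc j)"
    if A'0: "A' 0 = {}" and rec: "\<And>j. j < r' \<Longrightarrow>
        \<alpha>' (Suc j) = (MIN B\<in>{B. A' j \<subset> B \<and> B \<subseteq> E}. slope ?f (A' j) B)
      \<and> unique_largest_minimizer (slope ?f (A' j)) {B. A' j \<subset> B \<and> B \<subseteq> E} (A' (Suc j))"
      and j: "j < r'" and e: "e \<in> A' (Suc j) - A' j"
    for r' :: nat and \<alpha>' :: "nat \<Rightarrow> real" and A' j e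
  proof -
    \<comment> \<open>Both runs pick a unique largest minimizer at each stage, so they coincide by
      induction. Each stage enlarges the set strictly, which stops any run from continuing beyond
      \<open>E\<close>.\<close>
    have "k \<le> r' \<Longrightarrow> k \<le> r \<and> A' k = A k" for k
    proof (induction k)
      case (Suc k)
      hence k: "k < r'" "k \<le> r" "A' k = A k" by auto
      have larger: "A' (Suc k) \<in> {B. A k \<subset> B \<and> B \<subseteq> E}"
        using rec[OF k(1)] k(3) by (simp add: unique_largest_minimizer_def is_arg_min_def)
      hence "k \<noteq> r" using A_r by auto
      hence "k < r" using k by simp
      have "A' (Suc k) = A (Suc k)"
        using unique_largest_minimizer_unique[OF _ step(2)[OF \<open>k < r\<close>]] rec[OF k(1)] k(3) by simp
      thus ?case using \<open>k < r\<close> by simp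
    qed (simp add: A'0 A_0)
    from this[of j] this[of "Suc j"] have same: "A' j = A j" "A' (Suc j) = A (Suc j)" "j < r"
      using j by auto
    have "\<alpha>' (Suc j) = \<alpha> (Suc j)" using rec[OF j] step(1)[OF same(3)] same(1) by simp
    thus ?thesis using level_value[OF same(3)] e same by simp
  qed

  \<comment> \<open>The claims on \<open>c_min\<close> and \<open>E_min\<close> are stage 0 of the
    recursion: over the empty set the slope is the average density.\<close>
  have ne_sets: "{B. A 0 \<subset> B \<and> B \<subseteq> E} = {B. B \<noteq> {} \<and> B \<subseteq> E}" by (auto simp: A_0)
  have c_min_\<alpha>: "c_min = \<alpha> 1"
    unfolding c_min
  proof (rule Min_eqI)
    show "\<alpha> 1 \<in> c ` E" unfolding \<alpha>_values[symmetric] using r_pos by (intro imageI) simp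
    show "\<alpha> 1 \<le> y" if "y \<in> c ` E" for y
      using that \<alpha>_le[of 1] unfolding \<alpha>_values[symmetric] by auto
  qed (use fin in simp)
  have c_min_le: "c_min \<le> c e" if "e \<in> E" for e
    unfolding c_min using fin that by (intro Min_le) auto
  have E_min_A: "E_min = A 1"
    unfolding E_min A_j[OF order_refl r_pos] c_min_\<alpha>[symmetric] using c_min_le by (auto intro: antisym)
  have density: "c_min = (MIN B\<in>{B. B \<noteq> {} \<and> B \<subseteq> E}. avg_density ?f B)"
    "unique_largest_minimizer (avg_density ?f) {B. B \<noteq> {} \<and> B \<subseteq> E} E_min"
    using step[of 0] r_pos unfolding ne_sets unfolding A_0 slope_empty[of ?f, OF f_empty] c_min_\<alpha> E_min_A
    by simp_all
  note min_iff = min_density_iff(1)[OF fin density(1) edge]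
  have E_min_props: "E_min \<noteq> {}" "E_min \<subseteq> E" "?f E_min = c_min * real (card E_min)"
    and E_min_largest: "\<And>B. B \<noteq> {} \<Longrightarrow> B \<subseteq> E \<Longrightarrow> ?f B = c_min * real (card B) \<Longrightarrow> B \<subseteq> E_min"
    using density(2) unfolding unique_largest_minimizer_def mem_Collect_eq min_iff by auto
  have E_min_Union: "E_min = \<Union>{B. B \<subseteq> E \<and> B \<noteq> {} \<and> ?f B = c_min * real (card B)}"
    using E_min_props E_min_largest by blast
  show ?thesis
  proof (intro conjI)
    show "\<forall>e\<in>E. ((\<lambda>t. edge_curvature V E (w t) e) \<longlongrightarrow> c e) at_top"
      using conv[OF flow] cq by simp
    show "\<forall>w'. ricci_flow V E w' \<longrightarrow>
        (\<forall>e\<in>E. ((\<lambda>t. edge_curvature V E (w' t) e) \<longlongrightarrow> c e) at_top)"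
      using conv cq by simp
    show "\<forall>r' \<alpha>' A'. A' 0 = {} \<and> A' r' = E
          \<and> (\<forall>j<r'. \<alpha>' (Suc j) = (MIN B\<in>{B. A' j \<subset> B \<and> B \<subseteq> E}. slope ?f (A' j) B)
               \<and> unique_largest_minimizer (slope ?f (A' j)) {B. A' j \<subset> B \<and> B \<subseteq> E} (A' (Suc j)))
          \<longrightarrow> (\<forall>j<r'. \<forall>e\<in>A' (Suc j) - A' j. c e = \<alpha>' (Suc j))"
    proof (intro allI impI ballI, elim conjE)
      fix r' \<alpha>' A' j e
      assume "A' 0 = {}" "j < r'" "e \<in> A' (Suc j) - A' j"
        and *: "\<forall>j<r'. \<alpha>' (Suc j) = (MIN B\<in>{B. A' j \<subset> B \<and> B \<subseteq> E}. slope ?f (A' j) B)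
           \<and> unique_largest_minimizer (slope ?f (A' j)) {B. A' j \<subset> B \<and> B \<subseteq> E} (A' (Suc j))"
      thus "c e = \<alpha>' (Suc j)" by (intro recursion[of A' r' \<alpha>' j e, OF _ *[rule_format]])
    qed
    show "\<forall>z. is_arg_min (\<lambda>z. 1 / 2 * (\<Sum>e\<in>E. (z e)\<^sup>2)) (\<lambda>z. z \<in> base_polytope E ?f) z
        \<longleftrightarrow> (\<forall>e\<in>E. z e = c e)"
      using is_arg_min_norm_iff by (rule allI)
    show "\<forall>j\<le>r. ?f (A j) = (\<Sum>e\<in>A j. c e)" using tight_A by simp
    show "\<forall>j<r. \<alpha> (Suc j) = (MIN B\<in>{B. A j \<subset> B \<and> B \<subseteq> E}. slope ?f (A j) B)
        \<and> unique_largest_minimizer (slope ?f (A j)) {B. A j \<subset> B \<and> B \<subseteq> E} (A (Suc j))"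
      using step by (intro allI impI conjI)
    show "\<forall>B C. is_arg_min (avg_density ?f) (\<lambda>B. B \<noteq> {} \<and> B \<subseteq> E) B
          \<and> is_arg_min (avg_density ?f) (\<lambda>B. B \<noteq> {} \<and> B \<subseteq> E) C
        \<longrightarrow> is_arg_min (avg_density ?f) (\<lambda>B. B \<noteq> {} \<and> B \<subseteq> E) (B \<union> C)
          \<and> (B \<inter> C \<noteq> {} \<longrightarrow> is_arg_min (avg_density ?f) (\<lambda>B. B \<noteq> {} \<and> B \<subseteq> E) (B \<inter> C))"
      using min_density_lattice[OF fin submodular_beta f_empty] by (intro allI impI conjI; elim conjE)
  qed (fact submodular_beta A_r density E_min_Union E_min_props(3))+
qed

end
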